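(* Let $\rho>0$, let $f$ be a nonconstant holomorphic function on a neighborhood of $\rho\overline{\mathbb{D}}$, and consider the semigroup $(T_t)_{t\ge 0}$ on $X_\rho$ generated by the operator $f(\partial_x)$. Then the following assertions are equivalent: (i) $f(\rho\mathbb{D})\cap i\mathbb{R}\neq\emptyset$. (ii) $(T_t)_{t\ge0}$ is Devaney chaotic in $X_\rho$. (iii) Every autonomous discretization of $(T_t)_{t\ge 0}$ is Devaney chaotic in $X_\rho$. (iv) Some autonomous discretization of $(T_t)_{t\ge 0}$ is Devaney chaotic in $X_\rho$.
   Context: $\mathbb{D}=\{z\in\mathbb{C}:|z|<1\}$. For $\rho>0$ the Herzog space is $X_\rho=\{f:\mathbb{R}\to\mathbb{C}: f(x)=\sum_{n\ge0}\frac{a_n\rho^n}{n!}x^n,\ (a_n)_{n\ge0}\in c_0(\mathbb{N}_0)\}$ with norm $\|f\|=\sup_n|a_n|$ (isometrically isomorphic to complex $c_0(\mathbb{N}_0)$ via $f\mapsto(a_n)$). The derivative $\partial_x$ is a bounded operator on $X_\rho$ with $\sigma(\partial_x)=\rho\overline{\mathbb{D}}$; it corresponds to $\rho B$ on $c_0(\mathbb{N}_0)$, where $B$ is the backward shift. $f(\partial_x)$ is defined by the Riesz–Dunford functional calculus, is bounded, and generates $T_t=e^{tf(\partial_x)}$. An operator $T$ is Devaney chaotic if it has a dense orbit $\{T^kx:k\ge0\}$ for some $x$ and its set of periodic points is dense. A $C_0$-semigroup $(T_t)_{t\ge0}$ is Devaney chaotic if $\{T_tx:t\ge0\}$ is dense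 for some $x$ and the set of periodic points ($x$ with $T_tx=x$ for some $t>0$) is dense. An autonomous discretization of $(T_t)_{t\ge0}$ is the sequence $(T_{kt_0})_{k\ge 0}=(T_{t_0}^k)_{k\ge 0}$ of iterates of the operator $T_{t_0}$ for a fixed $t_0>0$; it is Devaney chaotic if the operator $T_{t_0}$ is. *)

theory Defs
  imports "HOL-Complex_Analysis.Complex_Analysis"
begin

class scaleC =
  fixes scaleC :: "complex \<Rightarrow> 'a \<Rightarrow> 'a"  (infixr \<open>*\<^sub>C\<close> 75)

class complex_banach = banach + scaleC +
  assumes scaleC_add_right: "c *\<^sub>C (x + y) = c *\<^sub>C x + c *\<^sub>C y"
    and scaleC_add_left: "(c + d) *\<^sub>C x = c *\<^sub>C x + d *\<^sub>C x"
    and scaleC_scaleC: "c *\<^sub>C (d *\<^sub>C x) = (c * d) *\<^sub>C x"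
    and scaleC_of_real: "of_real r *\<^sub>C x = r *\<^sub>R x"
    and norm_scaleC: "norm (c *\<^sub>C x) = cmod c * norm x"

lemma bounded_linear_scaleC: "bounded_linear ((*\<^sub>C) c :: 'a::complex_banach \<Rightarrow> 'a)"
proof (rule bounded_linear_intro[where K = "cmod c"])
  fix x y :: 'a and r :: real
  show "c *\<^sub>C (x + y) = c *\<^sub>C x + c *\<^sub>C y" by (rule scaleC_add_right)
  show "c *\<^sub>C (r *\<^sub>R x) = r *\<^sub>R (c *\<^sub>C x)"
    by (simp add: scaleC_of_real[symmetric] scaleC_scaleC mult.commute)
  show "norm (c *\<^sub>C x) \<le> norm x * cmod c"
    by (simp add: norm_scaleC mult.commute)
qed

lemma scaleC_one: "1 *\<^sub>C (x :: 'a::complex_banach) = x"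
  using scaleC_of_real[of 1 x] by simp

instantiation blinfun :: (real_normed_vector, complex_banach) complex_banach
begin

lift_definition scaleC_blinfun :: "complex \<Rightarrow> ('a \<Rightarrow>\<^sub>L 'b) \<Rightarrow> ('a \<Rightarrow>\<^sub>L 'b)"
  is "\<lambda>c A x. c *\<^sub>C A x"
  by (rule bounded_linear_compose[OF bounded_linear_scaleC])

instance
proof
  fix c d :: complex and A B :: "'a \<Rightarrow>\<^sub>L 'b" and r :: real
  show "c *\<^sub>C (A + B) = c *\<^sub>C A + c *\<^sub>C B"
    by transfer (simp add: scaleC_add_right)
  show "(c + d) *\<^sub>C A = c *\<^sub>C A + d *\<^sub>C A"
    by transfer (simp add: scaleC_add_left)
  show "c *\<^sub>C (d *\<^sub>C A) = (c * d) *\<^sub>C A"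
    by transfer (simp add: scaleC_scaleC)
  show "of_real r *\<^sub>C A = r *\<^sub>R A"
    by transfer (simp add: scaleC_of_real)
  show "norm (c *\<^sub>C A) = cmod c * norm A"
  proof (rule antisym)
    have le: "norm (c *\<^sub>C A) \<le> cmod c * norm A" for c and A :: "'a \<Rightarrow>\<^sub>L 'b"
    proof (rule norm_blinfun_bound)
      fix x
      have "norm (blinfun_apply (c *\<^sub>C A) x) = cmod c * norm (blinfun_apply A x)"
        by transfer (simp add: norm_scaleC)
      also have "\<dots> \<le> cmod c * (norm A * norm x)"
        by (intro mult_left_mono norm_blinfun) auto
      finally show "norm (blinfun_apply (c *\<^sub>C A) x) \<le> cmod c * norm A * norm x"
        by (simp add: mult.assoc)
    qed auto
    show "norm (c *\<^sub>C A) \<le> cmod c * norm A" by (rule le)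
    show "cmod c * norm A \<le> norm (c *\<^sub>C A)"
    proof (cases "c = 0")
      case False
      have "inverse c *\<^sub>C (c *\<^sub>C A) = A"
        using False by transfer (simp add: scaleC_scaleC scaleC_one)
      then have "norm A \<le> cmod (inverse c) * norm (c *\<^sub>C A)"
        using le[of "inverse c" "c *\<^sub>C A"] by simp
      then show ?thesis using False by (simp add: norm_inverse norm_divide field_simps)
    qed auto
  qed
qed

end

text \<open>
  A bounded operator is an element of \<open>'a \<Rightarrow>\<^sub>L 'a\<close>. The library type only enforces real linearity,
  but an invertible complex-linear operator has a complex-linear inverse, so for complex-linear
  operators spectrum and resolvent below are the usual ones.
\<close>

definition op_inverses :: "('a::complex_banach \<Rightarrow>\<^sub>L 'a) \<Rightarrow> ('a \<Rightarrow>\<^sub>L 'a) \<Rightarrow> bool" where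
  "op_inverses A R \<longleftrightarrow> A o\<^sub>L R = id_blinfun \<and> R o\<^sub>L A = id_blinfun"

definition spectrum :: "('a::complex_banach \<Rightarrow>\<^sub>L 'a) \<Rightarrow> complex set" where
  "spectrum A = {z. \<nexists>R. op_inverses (z *\<^sub>C id_blinfun - A) R}"

definition resolvent :: "('a::complex_banach \<Rightarrow>\<^sub>L 'a) \<Rightarrow> complex \<Rightarrow> ('a \<Rightarrow>\<^sub>L 'a)" where
  "resolvent A z = (THE R. op_inverses (z *\<^sub>C id_blinfun - A) R)"

definition surrounds_within :: "complex set \<Rightarrow> complex set \<Rightarrow> (real \<Rightarrow> complex) \<Rightarrow> bool" where
  "surrounds_within U S g \<longleftrightarrow>
     valid_path g \<and> pathfinish g = pathstart g \<and> path_image g \<subseteq> U - S \<and>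
     (\<forall>z\<in>S. winding_number g z = 1) \<and> (\<forall>z. z \<notin> U \<longrightarrow> winding_number g z = 0)"

text \<open>
  The Riesz--Dunford functional calculus
  \<open>f(A) = 1 / (2 \<pi> i) \<cdot> \<integral> f(z) (z - A)\<^sup>-\<^sup>1 dz\<close> for \<open>f\<close> holomorphic on the open set \<open>U\<close> containing the
  spectrum, the integral being taken in the operator norm. The value is the same for all contours.
  A single closed path suffices for a disc-shaped spectrum, as considered here; general spectra would
  require cycles.
\<close>

definition riesz_dunford ::
    "complex set \<Rightarrow> (complex \<Rightarrow> complex) \<Rightarrow> ('a::complex_banach \<Rightarrow>\<^sub>L 'a) \<Rightarrow> ('a \<Rightarrow>\<^sub>L 'a)" where
  "riesz_dunford U f A =
     (THE B. \<forall>g. surrounds_within U (spectrum A) g \<longrightarrow>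
        ((\<lambda>s. (f (g s) * vector_derivative g (at s within {0..1}) / (2 * of_real pi * \<i>))
               *\<^sub>C resolvent A (g s)) has_integral B) {0..1})"

primrec op_power :: "('a::complex_banach \<Rightarrow>\<^sub>L 'a) \<Rightarrow> nat \<Rightarrow> ('a \<Rightarrow>\<^sub>L 'a)" where
  "op_power A 0 = id_blinfun"
| "op_power A (Suc n) = A o\<^sub>L op_power A n"

definition op_exp :: "('a::complex_banach \<Rightarrow>\<^sub>L 'a) \<Rightarrow> ('a \<Rightarrow>\<^sub>L 'a)" where
  "op_exp A = (\<Sum>n. (1 / fact n) *\<^sub>R op_power A n)"

definition devaney_chaotic :: "'a topology \<Rightarrow> ('a \<Rightarrow> 'a) \<Rightarrow> bool" where
  "devaney_chaotic X T \<longleftrightarrow>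
     (\<exists>x\<in>topspace X. X closure_of (range (\<lambda>k::nat. (T ^^ k) x)) = topspace X) \<and>
     X closure_of {x \<in> topspace X. \<exists>k>0. (T ^^ k) x = x} = topspace X"

definition devaney_chaotic_semigroup :: "'a topology \<Rightarrow> (real \<Rightarrow> 'a \<Rightarrow> 'a) \<Rightarrow> bool" where
  "devaney_chaotic_semigroup X T \<longleftrightarrow>
     (\<exists>x\<in>topspace X. X closure_of ((\<lambda>t. T t x) ` {0..}) = topspace X) \<and>
     X closure_of {x \<in> topspace X. \<exists>t>0. T t x = x} = topspace X"

typedef c0 = "{a :: nat \<Rightarrow> complex. a \<longlonglongrightarrow> 0}"
  morphisms c0_nth Abs_c0
  by (rule exI[of _ "\<lambda>_. 0"]) simp

setup_lifting type_definition_c0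

lemma c0_eqI: "(\<And>n. c0_nth a n = c0_nth b n) \<Longrightarrow> a = b"
  by (metis c0_nth_inject ext)

instantiation c0 :: real_vector
begin
lift_definition zero_c0 :: c0 is "\<lambda>_. 0" by simp
lift_definition plus_c0 :: "c0 \<Rightarrow> c0 \<Rightarrow> c0" is "\<lambda>a b n. a n + b n"
  by (auto intro: tendsto_eq_intros)
lift_definition minus_c0 :: "c0 \<Rightarrow> c0 \<Rightarrow> c0" is "\<lambda>a b n. a n - b n"
  by (auto intro: tendsto_eq_intros)
lift_definition uminus_c0 :: "c0 \<Rightarrow> c0" is "\<lambda>a n. - a n"
  by (auto intro: tendsto_eq_intros)
lift_definition scaleR_c0 :: "real \<Rightarrow> c0 \<Rightarrow> c0" is "\<lambda>r a n. r *\<^sub>R a n"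
  by (auto intro: tendsto_eq_intros)
instance
  by standard (transfer; simp add: algebra_simps scaleR_add_left scaleR_add_right)+
end

lemma c0_nth_simps [simp]:
  "c0_nth 0 n = 0"
  "c0_nth (a + b) n = c0_nth a n + c0_nth b n"
  "c0_nth (a - b) n = c0_nth a n - c0_nth b n"
  "c0_nth (- a) n = - c0_nth a n"
  "c0_nth (r *\<^sub>R a) n = r *\<^sub>R c0_nth a n"
  by (transfer; simp)+

lemma c0_nth_tendsto: "c0_nth a \<longlonglongrightarrow> 0"
  using c0_nth by auto

instantiation c0 :: real_normed_vector
begin
definition norm_c0 :: "c0 \<Rightarrow> real" where "norm_c0 a = (SUP n. cmod (c0_nth a n))"
definition dist_c0 :: "c0 \<Rightarrow> c0 \<Rightarrow> real" where "dist_c0 a b = norm (a - b)"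
definition sgn_c0 :: "c0 \<Rightarrow> c0" where "sgn_c0 a = a /\<^sub>R norm a"
definition uniformity_c0 :: "(c0 \<times> c0) filter" where
  "uniformity_c0 = (INF e\<in>{0<..}. principal {(x, y). dist x y < e})"
definition open_c0 :: "c0 set \<Rightarrow> bool" where
  "open_c0 S \<longleftrightarrow> (\<forall>x\<in>S. \<forall>\<^sub>F (x', y) in uniformity. x' = x \<longrightarrow> y \<in> S)"

lemma c0_nth_le_norm: "cmod (c0_nth a n) \<le> norm a"
proof -
  have "bdd_above (range (\<lambda>n. cmod (c0_nth a n)))"
    using convergent_imp_bounded[OF c0_nth_tendsto[of a]]
    by (auto simp: bounded_iff bdd_above_def)
  then show ?thesis
    unfolding norm_c0_def by (rule cSUP_upper[rotated]) simp
qed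

lemma norm_c0_le: "(\<And>n. cmod (c0_nth a n) \<le> C) \<Longrightarrow> norm a \<le> C"
  unfolding norm_c0_def by (rule cSUP_least) auto

instance
proof
  fix a b :: c0 and r :: real
  show "norm a = 0 \<longleftrightarrow> a = 0"
  proof
    assume "norm a = 0"
    then show "a = 0"
      using c0_nth_le_norm[of a] by (intro c0_eqI) simp
  qed (simp add: norm_c0_def)
  show "norm (a + b) \<le> norm a + norm b"
    by (rule norm_c0_le) (simp add: norm_triangle_le add_mono c0_nth_le_norm)
  show "norm (r *\<^sub>R a) = \<bar>r\<bar> * norm a"
  proof (rule antisym)
    have le: "norm (r *\<^sub>R a) \<le> \<bar>r\<bar> * norm a" for r and a :: c0
      by (rule norm_c0_le) (simp add: mult_left_mono c0_nth_le_norm)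
    show "norm (r *\<^sub>R a) \<le> \<bar>r\<bar> * norm a" by (rule le)
    show "\<bar>r\<bar> * norm a \<le> norm (r *\<^sub>R a)"
    proof (cases "r = 0")
      case True
      then show ?thesis by (simp add: norm_c0_def)
    next
      case False
      then show ?thesis
        using le[of "inverse r" "r *\<^sub>R a"] by (simp add: field_simps)
    qed
  qed
qed (simp_all add: dist_c0_def sgn_c0_def uniformity_c0_def open_c0_def)
end

instantiation c0 :: complex_banach
begin
lift_definition scaleC_c0 :: "complex \<Rightarrow> c0 \<Rightarrow> c0" is "\<lambda>c a n. c * a n"
  by (auto intro: tendsto_eq_intros)

instance
proof
  fix X :: "nat \<Rightarrow> c0" assume X: "Cauchy X"
  have close: "\<exists>N. \<forall>m n. N \<le> m \<and> N \<le> n \<longrightarrow> (\<forall>k. dist (c0_nth (X m) k) (c0_nth (X n) k) < e)"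
    if "e > 0" for e
  proof -
    obtain N where N: "\<And>m n. m \<ge> N \<Longrightarrow> n \<ge> N \<Longrightarrow> norm (X m - X n) < e"
      using X \<open>e > 0\<close> unfolding Cauchy_def dist_norm by blast
    have "dist (c0_nth (X m) k) (c0_nth (X n) k) < e" if "m \<ge> N" "n \<ge> N" for m n k
      using N[OF that] c0_nth_le_norm[of "X m - X n" k] by (simp add: dist_norm)
    then show ?thesis by blast
  qed
  then obtain g where g:
      "\<And>e. e > 0 \<Longrightarrow> \<exists>N. \<forall>n\<ge>N. \<forall>k. dist (c0_nth (X n) k) (g k) < e"
    using uniformly_convergent_eq_cauchy[of "\<lambda>_. True" "\<lambda>n. c0_nth (X n)"] by auto
  have "g \<longlonglongrightarrow> 0"
  proof (rule LIMSEQ_I)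
    fix e :: real assume "e > 0"
    then obtain n where n: "\<And>k. dist (c0_nth (X n) k) (g k) < e / 2"
      using g[of "e / 2"] by auto
    obtain N where N: "\<And>k. k \<ge> N \<Longrightarrow> norm (c0_nth (X n) k) < e / 2"
      using LIMSEQ_D[OF c0_nth_tendsto[of "X n"], of "e / 2"] \<open>e > 0\<close> by auto
    have "norm (g k - 0) < e" if "k \<ge> N" for k
    proof -
      have "norm (g k) \<le> norm (c0_nth (X n) k) + dist (c0_nth (X n) k) (g k)"
        unfolding dist_norm by norm
      then show ?thesis using N[OF that] n[of k] by simp
    qed
    then show "\<exists>N. \<forall>k\<ge>N. norm (g k - 0) < e" by blast
  qed
  then have nth: "c0_nth (Abs_c0 g) = g"
    by (simp add: Abs_c0_inverse)
  have "X \<longlonglongrightarrow> Abs_c0 g"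
  proof (rule LIMSEQ_I)
    fix e :: real assume "e > 0"
    then obtain N where N: "\<And>n k. n \<ge> N \<Longrightarrow> dist (c0_nth (X n) k) (g k) < e / 2"
      using g[of "e / 2"] by auto
    have "norm (X n - Abs_c0 g) < e" if "n \<ge> N" for n
    proof -
      have "norm (X n - Abs_c0 g) \<le> e / 2"
        by (rule norm_c0_le) (use N[OF that] in \<open>auto simp: nth dist_norm intro: less_imp_le\<close>)
      then show ?thesis using \<open>e > 0\<close> by simp
    qed
    then show "\<exists>N. \<forall>n\<ge>N. norm (X n - Abs_c0 g) < e" by blast
  qed
  then show "convergent X" by (auto simp: convergent_def)
next
  fix c d :: complex and a b :: c0 and r :: real
  show "c *\<^sub>C (a + b) = c *\<^sub>C a + c *\<^sub>C b" by transfer (simp add: algebra_simps)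
  show "(c + d) *\<^sub>C a = c *\<^sub>C a + d *\<^sub>C a" by transfer (simp add: algebra_simps)
  show "c *\<^sub>C (d *\<^sub>C a) = (c * d) *\<^sub>C a" by transfer (simp add: algebra_simps)
  show "of_real r *\<^sub>C a = r *\<^sub>R a" by transfer (simp add: scaleR_conv_of_real)
  have nth: "c0_nth (c *\<^sub>C a) n = c * c0_nth a n" for c a n
    by transfer simp
  have le: "norm (c *\<^sub>C a) \<le> cmod c * norm a" for c and a :: c0
    by (rule norm_c0_le) (simp add: nth norm_mult mult_left_mono c0_nth_le_norm)
  show "norm (c *\<^sub>C a) = cmod c * norm a"
  proof (rule antisym)
    show "cmod c * norm a \<le> norm (c *\<^sub>C a)"
    proof (cases "c = 0")
      case False
      have "inverse c *\<^sub>C (c *\<^sub>C a) = a"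
        using False by (intro c0_eqI) (simp add: nth)
      then show ?thesis
        using le[of "inverse c" "c *\<^sub>C a"] False
        by (simp add: norm_inverse norm_divide field_simps)
    qed simp
  qed (rule le)
qed
end

definition herzog_fun :: "real \<Rightarrow> c0 \<Rightarrow> real \<Rightarrow> complex" where
  "herzog_fun \<rho> a x = (\<Sum>n. c0_nth a n * of_real (\<rho> ^ n / fact n * x ^ n))"

definition herzog_space :: "real \<Rightarrow> (real \<Rightarrow> complex) set" where
  "herzog_space \<rho> = range (herzog_fun \<rho>)"

definition herzog_coeffs :: "real \<Rightarrow> (real \<Rightarrow> complex) \<Rightarrow> c0" where
  "herzog_coeffs \<rho> h = (THE a. h = herzog_fun \<rho> a)"

definition herzog_norm :: "real \<Rightarrow> (real \<Rightarrow> complex) \<Rightarrow> real" where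
  "herzog_norm \<rho> h = (SUP n. cmod (c0_nth (herzog_coeffs \<rho> h) n))"

definition herzog_topology :: "real \<Rightarrow> (real \<Rightarrow> complex) topology" where
  "herzog_topology \<rho> =
     Metric_space.mtopology (herzog_space \<rho>) (\<lambda>h k. herzog_norm \<rho> (\<lambda>x. h x - k x))"

text \<open>
  The set \<open>herzog_space \<rho>\<close> depends on a real parameter and so is not a type. Its bounded operators
  are represented by those of the isometrically isomorphic space \<^typ>\<open>c0\<close>:
  \<open>A :: c0 \<Rightarrow>\<^sub>L c0\<close> represents the operator \<open>herzog_op \<rho> A\<close> on functions.
\<close>

definition herzog_op :: "real \<Rightarrow> (c0 \<Rightarrow>\<^sub>L c0) \<Rightarrow> (real \<Rightarrow> complex) \<Rightarrow> (real \<Rightarrow> complex)" where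
  "herzog_op \<rho> A h = herzog_fun \<rho> (blinfun_apply A (herzog_coeffs \<rho> h))"

definition herzog_deriv :: "real \<Rightarrow> (c0 \<Rightarrow>\<^sub>L c0)" where
  "herzog_deriv \<rho> =
     (THE A. \<forall>h\<in>herzog_space \<rho>. \<forall>x. (h has_vector_derivative herzog_op \<rho> A h x) (at x))"

definition herzog_semigroup ::
    "real \<Rightarrow> complex set \<Rightarrow> (complex \<Rightarrow> complex) \<Rightarrow> real \<Rightarrow> (real \<Rightarrow> complex) \<Rightarrow> (real \<Rightarrow> complex)" where
  "herzog_semigroup \<rho> U f t = herzog_op \<rho> (op_exp (t *\<^sub>R riesz_dunford U f (herzog_deriv \<rho>)))"

end

theory Submission
  imports Defs
begin

text \<open>
  Taking coefficients identifies the Herzog space with \<open>c\<^sub>0\<close> and the derivative with \<open>\<rho> B\<close>, where \<open>B\<close>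
  is the backward shift. For \<open>|l| < 1\<close> the geometric sequence \<open>(l\<^sup>n)\<close> lies in \<open>c\<^sub>0\<close> and is an
  eigenvector of \<open>\<rho> B\<close> for the eigenvalue \<open>\<rho> l\<close>. It is therefore an eigenvector of \<open>f(\<rho> B)\<close> for
  \<open>f(\<rho> l)\<close> and of \<open>T\<^sub>t\<close> for \<open>exp (t f(\<rho> l))\<close>.

  These eigenvectors are total in a strong sense (\<open>geom_total\<close>): those belonging to any set of
  parameters with a limit point in the open disc already span a dense subspace. A first consequence
  is that a bounded complex-linear operator that is diagonal on the geometric sequences is determined
  by its eigenvalues, its \<^emph>\<open>symbol\<close> (\<open>has_symbol_unique\<close>). Inverses, the independence of the
  Riesz--Dunford integral from its contour, the product rule of the functional calculus and the
  semigroup law thereby become identities between scalar functions; the scalar content of the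
  functional calculus is Cauchy's integral formula (\<open>has_symbol_riesz_dunford\<close>).

  (i) implies (iii): let \<open>f(z\<^sub>0)\<close> be imaginary with \<open>|z\<^sub>0| < \<rho>\<close>. By the open mapping theorem \<open>z\<^sub>0\<close> is a
  limit point of the sets where \<open>exp (t f)\<close> is of modulus less than 1, of modulus greater than 1, and a
  root of unity. By totality the Godefroy--Shapiro argument applies (\<open>chaotic_operator_criterion\<close>):
  the first two sets give a dense orbit, with the help of Baire's theorem, and the third one a dense
  set of periodic points.

  (iii) implies (iv) trivially, and (iv) implies (ii) because the iterates of \<open>T\<^sub>t\<close> are the operators
  \<open>T\<^bsub>kt\<^esub>\<close>.

  (ii) implies (i): suppose that \<open>f\<close> takes no imaginary value on the open disc. A point of period \<open>t\<close>
  is a zero of \<open>g(\<rho> B)\<close> with \<open>g = exp (t f) - 1\<close>, and \<open>g\<close> has no zero in the open disc and finitely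
  many on the boundary circle. Dividing these out, \<open>g(\<rho> B)\<close> is the product of an invertible operator
  and of factors \<open>\<rho> B - \<zeta>\<close> with \<open>|\<zeta>| = \<rho>\<close>, which are injective since their kernel would consist of
  sequences of constant modulus. Hence 0 is the only periodic point (\<open>exponential_fixed_point_trivial\<close>).
\<close>

section \<open>Totality of the geometric sequences\<close>

definition csubspace :: "'a::complex_banach set \<Rightarrow> bool" where
  "csubspace M \<longleftrightarrow> 0 \<in> M \<and> (\<forall>x\<in>M. \<forall>y\<in>M. x + y \<in> M) \<and> (\<forall>c. \<forall>x\<in>M. c *\<^sub>C x \<in> M)"

lemma csubspaceI:
  assumes "0 \<in> M" and "\<And>x y. x \<in> M \<Longrightarrow> y \<in> M \<Longrightarrow> x + y \<in> M"
    and "\<And>c x. x \<in> M \<Longrightarrow> c *\<^sub>C x \<in> M"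
  shows "csubspace M"
  using assms by (auto simp: csubspace_def)

lemma csubspace_0: "csubspace M \<Longrightarrow> 0 \<in> M"
  and csubspace_add: "csubspace M \<Longrightarrow> x \<in> M \<Longrightarrow> y \<in> M \<Longrightarrow> x + y \<in> M"
  and csubspace_scaleC: "csubspace M \<Longrightarrow> x \<in> M \<Longrightarrow> c *\<^sub>C x \<in> M"
  by (auto simp: csubspace_def)

lemma csubspace_diff:
  assumes "csubspace M" "x \<in> M" "y \<in> M"
  shows "x - y \<in> M"
proof -
  have "(-1) *\<^sub>C y = - y" using scaleC_of_real[of "-1" y] by simp
  then show ?thesis
    using csubspace_add[OF assms(1,2) csubspace_scaleC[OF assms(1,3), of "-1"]] by simp
qed

lemma csubspace_sum:
  assumes "csubspace M" "\<And>i. i \<in> I \<Longrightarrow> x i \<in> M"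
  shows "(\<Sum>i\<in>I. x i) \<in> M"
  using assms(2)
  by (induction I rule: infinite_finite_induct) (auto simp: csubspace_0 csubspace_add assms(1))

lemma csubspace_closure:
  assumes M: "csubspace M"
  shows "csubspace (closure M)"
proof (rule csubspaceI)
  show "0 \<in> closure M" using csubspace_0[OF M] closure_subset by blast
next
  fix x y assume "x \<in> closure M" "y \<in> closure M"
  then obtain X Y where "\<And>n. X n \<in> M" "X \<longlonglongrightarrow> x" "\<And>n. Y n \<in> M" "Y \<longlonglongrightarrow> y"
    unfolding closure_sequential by blast
  then show "x + y \<in> closure M"
    unfolding closure_sequential
    by (intro exI[of _ "\<lambda>n. X n + Y n"]) (auto intro: tendsto_add csubspace_add[OF M])
next
  fix c x assume "x \<in> closure M"
  then obtain X where "\<And>n. X n \<in> M" "X \<longlonglongrightarrow> x"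
    unfolding closure_sequential by blast
  then show "c *\<^sub>C x \<in> closure M"
    unfolding closure_sequential
    by (intro exI[of _ "\<lambda>n. c *\<^sub>C X n"])
       (auto intro: bounded_linear.tendsto[OF bounded_linear_scaleC] csubspace_scaleC[OF M])
qed

lemma c0_nth_scaleC [simp]: "c0_nth (c *\<^sub>C a) n = c * c0_nth a n"
  by transfer simp

lemma c0_nth_sum [simp]: "c0_nth (\<Sum>i\<in>I. x i) n = (\<Sum>i\<in>I. c0_nth (x i) n)"
  by (induction I rule: infinite_finite_induct) auto

text \<open>
  For \<open>a = |l|\<close> and \<open>a + s < 1\<close> this bounds the weights \<open>(n choose k) |l|\<^bsup>n-k\<^esup>\<close>, which are the moduli of the
  Taylor coefficients of \<open>l \<mapsto> l\<^sup>n\<close>, by a null sequence in \<open>n\<close>.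
\<close>
lemma binomial_term_le:
  fixes a s :: real
  assumes "a \<ge> 0" "s \<ge> 0"
  shows "of_nat (n choose k) * a ^ (n - k) * s ^ k \<le> (a + s) ^ n"
proof (cases "k \<le> n")
  case True
  have "of_nat (n choose k) * s ^ k * a ^ (n - k) \<le> (\<Sum>k\<le>n. of_nat (n choose k) * s ^ k * a ^ (n - k))"
    using True assms by (intro member_le_sum) auto
  also have "\<dots> = (s + a) ^ n" by (simp add: binomial_ring)
  finally show ?thesis by (simp add: algebra_simps)
qed (use assms in \<open>simp add: binomial_eq_0\<close>)

text \<open>
  The \<open>k\<close>-th Taylor coefficient at \<open>l\<close> of the \<open>c\<^sub>0\<close>-valued analytic function \<open>l \<mapsto> (l\<^sup>n)\<close> on the unit
  disc. The truncated subtraction is harmless, as the binomial coefficient vanishes for \<open>n < k\<close>; outside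
  the disc the value is a dummy.
\<close>
lift_definition jet :: "complex \<Rightarrow> nat \<Rightarrow> c0" is
  "\<lambda>l k n. if cmod l < 1 then of_nat (n choose k) * l ^ (n - k) else 0"
proof -
  fix l :: complex and k :: nat
  show "(\<lambda>n. if cmod l < 1 then of_nat (n choose k) * l ^ (n - k) else 0) \<longlonglongrightarrow> 0"
  proof (cases "cmod l < 1")
    case True
    define s where "s = (1 - cmod l) / 2"
    have s: "s > 0" "cmod l + s < 1" using True by (simp_all add: s_def field_simps)
    have "(\<lambda>n. (cmod l + s) ^ n / s ^ k) \<longlonglongrightarrow> 0 / s ^ k"
      using s by (intro tendsto_divide tendsto_const LIMSEQ_power_zero) auto
    moreover have "cmod (of_nat (n choose k) * l ^ (n - k)) \<le> (cmod l + s) ^ n / s ^ k" for n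
      using binomial_term_le[of "cmod l" s n k] s
      by (simp add: norm_mult norm_power field_simps)
    ultimately have "(\<lambda>n. of_nat (n choose k) * l ^ (n - k)) \<longlonglongrightarrow> 0"
      using Lim_null_comparison[of "\<lambda>n. of_nat (n choose k) * l ^ (n - k)"
          "\<lambda>n. (cmod l + s) ^ n / s ^ k" sequentially] by simp
    then show ?thesis using True by simp
  qed simp
qed

lemma c0_nth_jet: "cmod l < 1 \<Longrightarrow> c0_nth (jet l k) n = of_nat (n choose k) * l ^ (n - k)"
  by transfer simp

lemma c0_nth_jet_0: "c0_nth (jet 0 k) n = (if n = k then 1 else 0)"
  by (cases n k rule: linorder_cases) (auto simp: c0_nth_jet)

abbreviation geom :: "complex \<Rightarrow> c0" where "geom l \<equiv> jet l 0"

lemma c0_nth_geom: "cmod l < 1 \<Longrightarrow> c0_nth (geom l) n = l ^ n"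
  by (simp add: c0_nth_jet)

text \<open>
  In each coordinate the remainder is the tail \<open>j \<ge> k\<close> of the binomial expansion of \<open>(l + h)\<^sup>n\<close>. With
  \<open>s = 1 - |l|\<close> and \<open>q = |h| / s \<le> 1\<close> one has \<open>|h|\<^sup>j \<le> q\<^sup>k s\<^sup>j\<close> there, and what remains sums to at
  most \<open>(s + |l|)\<^sup>n = 1\<close>, uniformly in \<open>n\<close>.
\<close>
lemma jet_expansion:
  assumes l: "cmod l < 1" and h: "cmod h < 1 - cmod l"
  shows "norm (geom (l + h) - (\<Sum>j<k. h ^ j *\<^sub>C jet l j)) \<le> (cmod h / (1 - cmod l)) ^ k"
proof (rule norm_c0_le)
  fix n
  define s where "s = 1 - cmod l"
  have s: "s > 0" "cmod h < s" using l h by (auto simp: s_def)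
  define q where "q = cmod h / s"
  have q: "0 \<le> q" "q \<le> 1" "cmod h = q * s" using s by (auto simp: q_def)
  have lh: "cmod (l + h) < 1" using h norm_triangle_ineq[of l h] by linarith
  let ?t = "\<lambda>j. of_nat (n choose j) * h ^ j * l ^ (n - j)"
  have sub: "(\<Sum>j<k. ?t j) = (\<Sum>j\<in>{..n} \<inter> {..<k}. ?t j)"
    by (rule sum.mono_neutral_right) auto
  have "c0_nth (geom (l + h) - (\<Sum>j<k. h ^ j *\<^sub>C jet l j)) n
      = (\<Sum>j\<le>n. ?t j) - (\<Sum>j<k. ?t j)"
    using l lh by (simp add: c0_nth_jet add.commute[of l h] binomial_ring algebra_simps)
  also have "\<dots> = (\<Sum>j\<in>{..n} - {..<k}. ?t j)"
    unfolding sub by (subst sum.Int_Diff[of "{..n}" _ "{..<k}"]) auto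
  finally have "cmod (c0_nth (geom (l + h) - (\<Sum>j<k. h ^ j *\<^sub>C jet l j)) n)
      \<le> (\<Sum>j\<in>{..n} - {..<k}. cmod (?t j))"
    by (metis norm_sum)
  also have "\<dots> \<le> (\<Sum>j\<in>{..n} - {..<k}. q ^ k * (of_nat (n choose j) * s ^ j * cmod l ^ (n - j)))"
  proof (rule sum_mono)
    fix j assume "j \<in> {..n} - {..<k}"
    then have "q ^ j \<le> q ^ k" using q by (intro power_decreasing) auto
    have "cmod (?t j) = q ^ j * (of_nat (n choose j) * s ^ j * cmod l ^ (n - j))"
      using q by (simp add: norm_mult norm_power power_mult_distrib)
    also have "\<dots> \<le> q ^ k * (of_nat (n choose j) * s ^ j * cmod l ^ (n - j))"
      using \<open>q ^ j \<le> q ^ k\<close> s by (intro mult_right_mono) auto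
    finally show "cmod (?t j) \<le> q ^ k * (of_nat (n choose j) * s ^ j * cmod l ^ (n - j))" .
  qed
  also have "\<dots> \<le> (\<Sum>j\<le>n. q ^ k * (of_nat (n choose j) * s ^ j * cmod l ^ (n - j)))"
    using q s by (intro sum_mono2) auto
  also have "\<dots> = q ^ k * (s + cmod l) ^ n"
    by (simp add: binomial_ring sum_distrib_left)
  also have "\<dots> = q ^ k" by (simp add: s_def)
  finally show "cmod (c0_nth (geom (l + h) - (\<Sum>j<k. h ^ j *\<^sub>C jet l j)) n)
      \<le> (cmod h / (1 - cmod l)) ^ k" by (simp add: q_def s_def)
qed

text \<open>
  The \<open>k\<close>-th jet is the limit, along the points \<open>x\<close> of the given set that tend to \<open>l\<close>, of the quotients
  \<open>(geom x - (\<Sum>j<k. (x - l)\<^sup>j *\<^sub>C jet l j)) / (x - l)\<^sup>k\<close>, which lie in \<open>M\<close> by induction.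
\<close>
lemma jet_in_closed_csubspace:
  assumes M: "csubspace M" "closed M" and l: "cmod l < 1"
    and lim: "l islimpt {x. cmod x < 1 \<and> geom x \<in> M}"
  shows "jet l k \<in> M"
proof (induction k rule: less_induct)
  case (less k)
  define s where "s = 1 - cmod l"
  have s: "s > 0" using l by (simp add: s_def)
  show ?case
  proof (rule closed_approachable[OF M(2), THEN iffD1], intro allI impI)
    fix e :: real assume e: "e > 0"
    define d where "d = min s (e * s ^ Suc k)"
    have "d > 0" using s e by (simp add: d_def)
    then obtain x where x: "cmod x < 1" "geom x \<in> M" "x \<noteq> l" "dist x l < d"
      using lim unfolding islimpt_approachable by blast
    define h where "h = x - l"
    have h: "h \<noteq> 0" "cmod h < s" "cmod h < e * s ^ Suc k" "x = l + h"
      using x by (auto simp: h_def d_def dist_norm)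
    define y where "y = inverse (h ^ k) *\<^sub>C (geom x - (\<Sum>j<k. h ^ j *\<^sub>C jet l j))"
    have "y \<in> M" unfolding y_def
      using less x(2) by (intro csubspace_scaleC csubspace_diff csubspace_sum M) auto
    moreover have "dist y (jet l k) < e"
    proof -
      have "y - jet l k = inverse (h ^ k) *\<^sub>C (geom x - (\<Sum>j<Suc k. h ^ j *\<^sub>C jet l j))"
        using h(1) by (intro c0_eqI) (simp add: y_def field_simps)
      then have "norm (y - jet l k)
          = norm (geom x - (\<Sum>j<Suc k. h ^ j *\<^sub>C jet l j)) / cmod h ^ k"
        by (simp only: norm_scaleC norm_inverse norm_power divide_inverse mult.commute)
      also have "\<dots> \<le> (cmod h / s) ^ Suc k / cmod h ^ k"
        using jet_expansion[OF l, of h "Suc k"] h unfolding s_def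
        by (intro divide_right_mono) auto
      also have "\<dots> = cmod h / s ^ Suc k"
        using h(1) by (simp add: power_divide)
      also have "\<dots> < e" using h(3) s by (simp add: field_simps)
      finally show ?thesis by (simp add: dist_norm)
    qed
    ultimately show "\<exists>y\<in>M. dist y (jet l k) < e" by blast
  qed
qed

lemma geom_in_closed_csubspace:
  assumes M: "csubspace M" "closed M" and l: "cmod l < 1" and h: "cmod h < 1 - cmod l"
    and jets: "\<And>k. jet l k \<in> M"
  shows "geom (l + h) \<in> M"
proof (rule closed_sequentially[OF M(2)])
  show "(\<Sum>j<k. h ^ j *\<^sub>C jet l j) \<in> M" for k
    using jets by (intro csubspace_sum csubspace_scaleC M)
  have "(\<lambda>k. (cmod h / (1 - cmod l)) ^ k) \<longlonglongrightarrow> 0"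
    using l h by (intro LIMSEQ_power_zero) auto
  then have "(\<lambda>k. geom (l + h) - (\<Sum>j<k. h ^ j *\<^sub>C jet l j)) \<longlonglongrightarrow> 0"
    by (rule Lim_null_comparison[OF always_eventually[OF allI[OF jet_expansion[OF l h]]]])
  from tendsto_diff[OF tendsto_const[of "geom (l + h)"] this]
  show "(\<lambda>k. \<Sum>j<k. h ^ j *\<^sub>C jet l j) \<longlonglongrightarrow> geom (l + h)" by simp
qed

lemma c0_nth_finite_combination:
  "c0_nth (\<Sum>j<N. a j *\<^sub>C jet 0 j) n = (if n < N then a n else 0)"
proof -
  have "c0_nth (\<Sum>j<N. a j *\<^sub>C jet 0 j) n = (\<Sum>j<N. if n = j then a j else 0)"
    unfolding c0_nth_sum by (rule sum.cong) (simp_all add: c0_nth_jet_0)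
  then show ?thesis by simp
qed

text \<open>
  The jets at 0 are the unit vectors, so they span the finitely supported sequences.
\<close>
lemma unit_vectors_span:
  assumes M: "csubspace M" "closed M" and unit: "\<And>k. jet 0 k \<in> M"
  shows "M = UNIV"
proof (intro set_eqI iffI UNIV_I)
  fix x :: c0
  show "x \<in> M"
  proof (rule closed_approachable[OF M(2), THEN iffD1], intro allI impI)
    fix e :: real assume e: "e > 0"
    obtain N where N: "\<And>n. n \<ge> N \<Longrightarrow> cmod (c0_nth x n) < e / 2"
      using LIMSEQ_D[OF c0_nth_tendsto[of x], of "e / 2"] e by auto
    have "norm ((\<Sum>j<N. c0_nth x j *\<^sub>C jet 0 j) - x) \<le> e / 2"
      using N e by (intro norm_c0_le) (auto simp: c0_nth_finite_combination simp del: c0_nth_sum intro: less_imp_le)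
    then have "dist (\<Sum>j<N. c0_nth x j *\<^sub>C jet 0 j) x < e" using e by (simp add: dist_norm)
    moreover have "(\<Sum>j<N. c0_nth x j *\<^sub>C jet 0 j) \<in> M"
      using unit by (intro csubspace_sum csubspace_scaleC M)
    ultimately show "\<exists>y\<in>M. dist y x < e" by blast
  qed
qed

text \<open>
  An identity theorem for the vector-valued function \<open>geom\<close>, which replaces the usual appeal to the dual
  space: the points of the disc all of whose jets lie in \<open>M\<close> form an open and relatively closed set. It
  contains \<open>l\<close>, hence 0, where the jets are the unit vectors.
\<close>
theorem geom_total:
  assumes M: "csubspace M" "closed M" and l: "cmod l < 1"
    and lim: "l islimpt {x. cmod x < 1 \<and> geom x \<in> M}"
  shows "M = UNIV"
proof -
  let ?D = "ball 0 1 :: complex set"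
  define W where "W = {x. cmod x < 1 \<and> geom x \<in> M}"
  define G where "G = {x\<in>?D. \<forall>k. jet x k \<in> M}"
  have GW: "G \<subseteq> W" by (auto simp: G_def W_def)
  have limG: "x \<in> G" if "cmod x < 1" "x islimpt W" for x
    using jet_in_closed_csubspace[OF M that(1)] that unfolding W_def G_def by auto
  have "closedin (top_of_set ?D) G"
    unfolding closedin_limpt using limG islimpt_subset[OF _ GW] by (auto simp: G_def)
  moreover have "openin (top_of_set ?D) G"
    unfolding openin_contains_ball
  proof (intro conjI ballI)
    show "G \<subseteq> ?D" by (auto simp: G_def)
    fix x assume x: "x \<in> G"
    define s where "s = 1 - cmod x"
    have s: "s > 0" using x by (auto simp: s_def G_def)
    have sub: "ball x s \<subseteq> W"
    proof
      fix y assume y: "y \<in> ball x s"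
      then have "cmod (y - x) < 1 - cmod x" by (simp add: s_def dist_norm norm_minus_commute)
      moreover from this have "cmod y < 1"
        using norm_triangle_ineq2[of y x] by simp
      ultimately show "y \<in> W"
        using geom_in_closed_csubspace[OF M, of x "y - x"] x by (auto simp: G_def W_def)
    qed
    have "ball x s \<inter> ?D \<subseteq> G"
    proof
      fix y assume y: "y \<in> ball x s \<inter> ?D"
      then have "y islimpt ball x s"
        by (intro interior_limit_point) (simp add: interior_open)
      with sub y show "y \<in> G" by (intro limG) (auto intro: islimpt_subset)
    qed
    with s show "\<exists>e>0. ball x e \<inter> ?D \<subseteq> G" by blast
  qed
  moreover have "l \<in> G" using limG[OF l] lim by (simp add: W_def)
  ultimately have "G = ?D"
    using connected_ball[of "0::complex" 1] unfolding connected_clopen by blast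
  then have "0 \<in> G" by simp
  then show ?thesis by (intro unit_vectors_span M) (auto simp: G_def)
qed

corollary dense_csubspace:
  assumes M: "csubspace M" and l: "cmod l < 1"
    and lim: "l islimpt {x. cmod x < 1 \<and> geom x \<in> M}"
  shows "closure M = UNIV"
proof (rule geom_total[OF csubspace_closure[OF M] closed_closure l])
  show "l islimpt {x. cmod x < 1 \<and> geom x \<in> closure M}"
    by (rule islimpt_subset[OF lim]) (use closure_subset in blast)
qed

section \<open>Operators that are diagonal on the geometric sequences\<close>

text \<open>
  A separate condition, because the type of bounded operators only records real linearity.
\<close>
definition clinear_op :: "('a::complex_banach \<Rightarrow>\<^sub>L 'a) \<Rightarrow> bool" where
  "clinear_op A \<longleftrightarrow> (\<forall>c x. blinfun_apply A (c *\<^sub>C x) = c *\<^sub>C blinfun_apply A x)"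

lemma scaleC_zero_right: "c *\<^sub>C (0 :: 'a::complex_banach) = 0"
  using norm_scaleC[of c 0] by simp

lemma scaleC_zero_left [simp]: "0 *\<^sub>C (x :: 'a::complex_banach) = 0"
  using norm_scaleC[of 0 x] by simp

lemma bounded_linear_scaleC_left: "bounded_linear (\<lambda>c. c *\<^sub>C (x :: 'a::complex_banach))"
proof (rule bounded_linear_intro[where K = "norm x"])
  fix r :: real and c
  show "(r *\<^sub>R c) *\<^sub>C x = r *\<^sub>R (c *\<^sub>C x)"
    by (simp add: scaleR_conv_of_real scaleC_of_real[symmetric] scaleC_scaleC)
qed (auto simp: scaleC_add_left norm_scaleC)

lemma blinfun_scaleC [simp]: "blinfun_apply (c *\<^sub>C A) x = c *\<^sub>C blinfun_apply A x"
  by transfer simp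

lemma csubspace_blinfun_eq:
  assumes "clinear_op A" "clinear_op B"
  shows "csubspace {x. blinfun_apply A x = blinfun_apply B x}"
  using assms by (auto simp: csubspace_def clinear_op_def blinfun.add_right)

lemma closed_blinfun_eq: "closed {x. blinfun_apply A x = blinfun_apply B x}"
  by (intro closed_Collect_eq linear_continuous_on blinfun.bounded_linear_right)

definition has_symbol :: "(c0 \<Rightarrow>\<^sub>L c0) \<Rightarrow> (complex \<Rightarrow> complex) \<Rightarrow> bool" where
  "has_symbol A h \<longleftrightarrow> clinear_op A \<and> (\<forall>l. cmod l < 1 \<longrightarrow> blinfun_apply A (geom l) = h l *\<^sub>C geom l)"

lemma has_symbol_clinear: "has_symbol A h \<Longrightarrow> blinfun_apply A (c *\<^sub>C x) = c *\<^sub>C blinfun_apply A x"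
  by (simp add: has_symbol_def clinear_op_def)

lemma has_symbol_geom: "has_symbol A h \<Longrightarrow> cmod l < 1 \<Longrightarrow> blinfun_apply A (geom l) = h l *\<^sub>C geom l"
  by (simp add: has_symbol_def)

text \<open>
  The equaliser of two such operators is a closed complex subspace that contains every geometric
  sequence.
\<close>
theorem has_symbol_unique:
  assumes A: "has_symbol A h" and B: "has_symbol B k"
    and eq: "\<And>l. cmod l < 1 \<Longrightarrow> h l = k l"
  shows "A = B"
proof -
  let ?M = "{x. blinfun_apply A x = blinfun_apply B x}"
  have "{l. cmod l < 1 \<and> geom l \<in> ?M} = ball 0 1"
    using A B eq by (auto simp: has_symbol_def)
  moreover have "(0::complex) islimpt ball 0 1" by (simp add: islimpt_ball)
  ultimately have "?M = UNIV"
    using A B by (intro geom_total[of ?M 0] csubspace_blinfun_eq closed_blinfun_eq)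
                 (auto simp: has_symbol_def)
  then show ?thesis by (intro blinfun_eqI) auto
qed

lemma has_symbol_id: "has_symbol id_blinfun (\<lambda>_. 1)"
  by (simp add: has_symbol_def clinear_op_def scaleC_one)

lemma has_symbol_compose:
  "has_symbol A h \<Longrightarrow> has_symbol B k \<Longrightarrow> has_symbol (A o\<^sub>L B) (\<lambda>l. h l * k l)"
  by (simp add: has_symbol_def clinear_op_def scaleC_scaleC mult.commute)

lemma has_symbol_0: "has_symbol 0 (\<lambda>_. 0)"
  by (simp add: has_symbol_def clinear_op_def scaleC_zero_right)

lemma has_symbol_add:
  "has_symbol A h \<Longrightarrow> has_symbol B k \<Longrightarrow> has_symbol (A + B) (\<lambda>l. h l + k l)"
  by (simp add: has_symbol_def clinear_op_def blinfun.add_left scaleC_add_left scaleC_add_right)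

lemma has_symbol_scaleC: "has_symbol A h \<Longrightarrow> has_symbol (c *\<^sub>C A) (\<lambda>l. c * h l)"
  by (simp add: has_symbol_def clinear_op_def scaleC_scaleC mult.commute)

lemma has_symbol_scaleR: "has_symbol A h \<Longrightarrow> has_symbol (r *\<^sub>R A) (\<lambda>l. of_real r * h l)"
  using has_symbol_scaleC[of A h "of_real r"] by (simp add: scaleC_of_real)

lemma has_symbol_diff:
  assumes "has_symbol A h" "has_symbol B k"
  shows "has_symbol (A - B) (\<lambda>l. h l - k l)"
  using has_symbol_add[OF assms(1) has_symbol_scaleR[OF assms(2), of "-1"]] by simp

lemma has_symbol_sum:
  "(\<And>i. i \<in> I \<Longrightarrow> has_symbol (A i) (h i)) \<Longrightarrow> has_symbol (\<Sum>i\<in>I. A i) (\<lambda>l. \<Sum>i\<in>I. h i l)"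
  by (induction I rule: infinite_finite_induct) (simp_all add: has_symbol_0 has_symbol_add)

lemma has_symbol_op_power: "has_symbol A h \<Longrightarrow> has_symbol (op_power A n) (\<lambda>l. h l ^ n)"
  by (induction n) (simp_all add: has_symbol_id has_symbol_compose)

lemma has_symbol_limit:
  assumes A: "\<And>n. has_symbol (A n) (h n)" and lim: "A \<longlonglongrightarrow> B"
    and h: "\<And>l. cmod l < 1 \<Longrightarrow> (\<lambda>n. h n l) \<longlonglongrightarrow> k l"
  shows "has_symbol B k"
proof -
  have lim': "(\<lambda>n. blinfun_apply (A n) x) \<longlonglongrightarrow> blinfun_apply B x" for x
    by (rule blinfun.tendsto[OF lim tendsto_const])
  have "blinfun_apply B (c *\<^sub>C x) = c *\<^sub>C blinfun_apply B x" for c x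
    using bounded_linear.tendsto[OF bounded_linear_scaleC lim', of c x] lim'[of "c *\<^sub>C x"]
    by (simp add: has_symbol_clinear[OF A] LIMSEQ_unique)
  moreover have "blinfun_apply B (geom l) = k l *\<^sub>C geom l" if "cmod l < 1" for l
    using bounded_linear.tendsto[OF bounded_linear_scaleC_left h[OF that], of "geom l"]
      lim'[of "geom l"] unfolding has_symbol_geom[OF A that] by (rule LIMSEQ_unique[symmetric])
  ultimately show ?thesis by (simp add: has_symbol_def clinear_op_def)
qed

lemma has_symbol_suminf:
  assumes "\<And>n. has_symbol (A n) (h n)" "summable A"
    and "\<And>l. cmod l < 1 \<Longrightarrow> (\<lambda>n. h n l) sums k l"
  shows "has_symbol (\<Sum>n. A n) k"
proof (rule has_symbol_limit)
  show "has_symbol (\<Sum>n<N. A n) (\<lambda>l. \<Sum>n<N. h n l)" for N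
    by (intro has_symbol_sum assms(1))
  show "(\<lambda>N. \<Sum>n<N. A n) \<longlonglongrightarrow> (\<Sum>n. A n)"
    by (rule summable_LIMSEQ[OF assms(2)])
  show "(\<lambda>N. \<Sum>n<N. h n l) \<longlonglongrightarrow> k l" if "cmod l < 1" for l
    using assms(3)[OF that] by (simp add: sums_def)
qed

text \<open>
  Applying an operator to a fixed vector is bounded linear in the operator, so it commutes with the
  integral; only the scalar integrals of the symbols have to be known.
\<close>
lemma has_symbol_integral:
  fixes F :: "real \<Rightarrow> c0 \<Rightarrow>\<^sub>L c0"
  assumes F: "\<And>s. s \<in> S \<Longrightarrow> has_symbol (F s) (h s)" and int: "(F has_integral B) S"
    and h: "\<And>l. cmod l < 1 \<Longrightarrow> ((\<lambda>s. h s l) has_integral k l) S"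
  shows "has_symbol B k"
proof -
  have eval: "((\<lambda>s. blinfun_apply (F s) x) has_integral blinfun_apply B x) S" for x
    using has_integral_linear[OF int blinfun.bounded_linear_left[of x]] by (simp add: o_def)
  have "blinfun_apply B (c *\<^sub>C x) = c *\<^sub>C blinfun_apply B x" for c x
  proof -
    have "((\<lambda>s. c *\<^sub>C blinfun_apply (F s) x) has_integral c *\<^sub>C blinfun_apply B x) S"
      using has_integral_linear[OF eval[of x] bounded_linear_scaleC[of c]] by (simp add: o_def)
    then have "((\<lambda>s. blinfun_apply (F s) (c *\<^sub>C x)) has_integral c *\<^sub>C blinfun_apply B x) S"
      by (rule has_integral_eq[rotated]) (simp add: has_symbol_clinear[OF F])
    then show ?thesis using eval has_integral_unique by blast
  qed
  moreover have "blinfun_apply B (geom l) = k l *\<^sub>C geom l" if "cmod l < 1" for l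
  proof -
    have "((\<lambda>s. h s l *\<^sub>C geom l) has_integral k l *\<^sub>C geom l) S"
      using has_integral_linear[OF h[OF that] bounded_linear_scaleC_left, of "geom l"]
      by (simp add: o_def)
    then have "((\<lambda>s. blinfun_apply (F s) (geom l)) has_integral k l *\<^sub>C geom l) S"
      by (rule has_integral_eq[rotated]) (simp add: has_symbol_geom[OF F that])
    then show ?thesis using eval has_integral_unique by blast
  qed
  ultimately show ?thesis by (simp add: has_symbol_def clinear_op_def)
qed

lemma norm_op_power: "norm (op_power A n) \<le> norm A ^ n"
proof (induction n)
  case (Suc n)
  have "norm (A o\<^sub>L op_power A n) \<le> norm A * norm (op_power A n)"
    by (rule norm_blinfun_compose)
  with Suc show ?case
    by (simp add: mult_left_mono order_trans)
qed (simp add: norm_blinfun_id_le)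

lemma has_symbol_op_exp:
  assumes A: "has_symbol A h"
  shows "has_symbol (op_exp A) (\<lambda>l. exp (h l))"
  unfolding op_exp_def
proof (rule has_symbol_suminf)
  show "has_symbol ((1 / fact n) *\<^sub>R op_power A n) (\<lambda>l. of_real (1 / fact n) * h l ^ n)" for n
    by (intro has_symbol_scaleR has_symbol_op_power A)
  show "summable (\<lambda>n. (1 / fact n) *\<^sub>R op_power A n)"
  proof (rule summable_comparison_test')
    show "summable (\<lambda>n. inverse (fact n) * norm A ^ n)" by (rule summable_exp)
    show "norm ((1 / fact n) *\<^sub>R op_power A n) \<le> inverse (fact n) * norm A ^ n" for n
      using norm_op_power[of A n] by (simp add: divide_inverse mult_left_mono)
  qed
  show "(\<lambda>n. of_real (1 / fact n) * h l ^ n) sums exp (h l)" for l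
    using exp_converges[of "h l"] by (simp add: scaleR_conv_of_real divide_inverse)
qed

section \<open>Resolvent and spectrum of the scaled backward shift\<close>

lift_definition back_shift :: "c0 \<Rightarrow> c0" is "\<lambda>a n. a (Suc n)"
  by (rule LIMSEQ_Suc)

lemma c0_nth_back_shift [simp]: "c0_nth (back_shift a) n = c0_nth a (Suc n)"
  by transfer simp

lemma bounded_linear_back_shift: "bounded_linear back_shift"
  by (rule bounded_linear_intro[where K = 1])
     (auto intro!: c0_eqI norm_c0_le c0_nth_le_norm)

definition scaled_shift :: "real \<Rightarrow> (c0 \<Rightarrow>\<^sub>L c0)" where
  "scaled_shift \<rho> = \<rho> *\<^sub>R Blinfun back_shift"

lemma c0_nth_scaled_shift [simp]:
  "c0_nth (blinfun_apply (scaled_shift \<rho>) x) n = of_real \<rho> * c0_nth x (Suc n)"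
  by (simp add: scaled_shift_def blinfun.scaleR_left bounded_linear_Blinfun_apply
      bounded_linear_back_shift scaleR_conv_of_real)

lemma norm_scaled_shift: "\<rho> > 0 \<Longrightarrow> norm (scaled_shift \<rho>) \<le> \<rho>"
  by (intro norm_blinfun_bound norm_c0_le) (auto simp: norm_mult intro!: mult_left_mono c0_nth_le_norm)

lemma has_symbol_scaled_shift: "has_symbol (scaled_shift \<rho>) (\<lambda>l. of_real \<rho> * l)"
  unfolding has_symbol_def clinear_op_def by (auto intro!: c0_eqI simp: c0_nth_geom)

text \<open>
  Summed over \<open>n\<close> these give the Neumann series of the resolvent at \<open>z\<close>.
\<close>
definition neumann_term :: "real \<Rightarrow> complex \<Rightarrow> nat \<Rightarrow> (c0 \<Rightarrow>\<^sub>L c0)" where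
  "neumann_term \<rho> z n = inverse (z ^ Suc n) *\<^sub>C op_power (scaled_shift \<rho>) n"

lemma norm_neumann_term:
  assumes \<rho>: "\<rho> > 0" and z: "q \<le> cmod z" and q: "\<rho> < q"
  shows "norm (neumann_term \<rho> z n) \<le> inverse q * (\<rho> / q) ^ n"
proof -
  have "norm (op_power (scaled_shift \<rho>) n) \<le> \<rho> ^ n"
    using norm_op_power[of "scaled_shift \<rho>" n] power_mono[OF norm_scaled_shift[OF \<rho>] norm_ge_zero]
    by (rule order_trans)
  moreover have "inverse (cmod z ^ Suc n) \<le> inverse (q ^ Suc n)"
    using z q \<rho> by (intro le_imp_inverse_le power_mono) auto
  ultimately have "norm (neumann_term \<rho> z n) \<le> inverse (q ^ Suc n) * \<rho> ^ n"
    using z q \<rho> unfolding neumann_term_def norm_scaleC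
    by (intro mult_mono) (auto simp: norm_inverse norm_mult norm_power)
  then show ?thesis by (simp add: power_divide divide_inverse power_inverse algebra_simps)
qed

lemma summable_neumann_bound:
  fixes \<rho> q :: real
  assumes "\<rho> > 0" "\<rho> < q"
  shows "summable (\<lambda>n. inverse q * (\<rho> / q) ^ n)"
  using assms by (intro summable_mult summable_geometric) auto

lemma has_symbol_neumann:
  assumes \<rho>: "\<rho> > 0" and z: "\<rho> < cmod z"
  shows "has_symbol (\<Sum>n. neumann_term \<rho> z n) (\<lambda>l. 1 / (z - of_real \<rho> * l))"
proof (rule has_symbol_suminf)
  show "has_symbol (neumann_term \<rho> z n) (\<lambda>l. inverse (z ^ Suc n) * (of_real \<rho> * l) ^ n)" for n
    unfolding neumann_term_def
    by (intro has_symbol_scaleC has_symbol_op_power has_symbol_scaled_shift)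
  show "summable (neumann_term \<rho> z)"
    by (rule summable_comparison_test'[OF summable_neumann_bound[OF \<rho> z]])
       (rule norm_neumann_term[OF \<rho> order_refl z])
  fix l :: complex assume l: "cmod l < 1"
  have z0: "z \<noteq> 0" using \<rho> z by auto
  have "\<rho> * cmod l < cmod z"
    using mult_strict_left_mono[OF l \<rho>] z by linarith
  then have "cmod (of_real \<rho> * l) < cmod z" using \<rho> by (simp add: norm_mult)
  then have "cmod (of_real \<rho> * l / z) < 1" using z0 by (simp add: norm_divide)
  then have "(\<lambda>n. inverse z * (of_real \<rho> * l / z) ^ n) sums (inverse z * (1 / (1 - of_real \<rho> * l / z)))"
    by (intro sums_mult geometric_sums)
  moreover have "inverse z * (1 / (1 - of_real \<rho> * l / z)) = 1 / (z - of_real \<rho> * l)"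
    using z0 by (simp add: field_simps)
  moreover have "inverse z * (of_real \<rho> * l / z) ^ n = inverse (z ^ Suc n) * (of_real \<rho> * l) ^ n" for n
    by (simp add: divide_inverse power_inverse power_mult_distrib mult_ac)
  ultimately show "(\<lambda>n. inverse (z ^ Suc n) * (of_real \<rho> * l) ^ n) sums (1 / (z - of_real \<rho> * l))"
    by simp
qed

lemma has_symbol_shifted:
  "has_symbol (z *\<^sub>C id_blinfun - scaled_shift \<rho>) (\<lambda>l. z - of_real \<rho> * l)"
  using has_symbol_diff[OF has_symbol_scaleC[OF has_symbol_id, of z] has_symbol_scaled_shift[of \<rho>]]
  by simp

lemma op_inverses_unique:
  assumes "op_inverses A R" "op_inverses A R'"
  shows "R = R'"
proof (rule blinfun_eqI)
  fix x
  have "blinfun_apply A (blinfun_apply R' x) = x" "blinfun_apply R (blinfun_apply A y) = y" for y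
    using assms unfolding op_inverses_def
    by (metis blinfun_apply_blinfun_compose blinfun_apply_id_blinfun id_apply)+
  then show "blinfun_apply R x = blinfun_apply R' x" by metis
qed

text \<open>
  The symbols \<open>z - \<rho> l\<close> and \<open>1 / (z - \<rho> l)\<close> are inverse to each other, hence so are the operators.
\<close>
lemma op_inverses_neumann:
  assumes \<rho>: "\<rho> > 0" and z: "\<rho> < cmod z"
  shows "op_inverses (z *\<^sub>C id_blinfun - scaled_shift \<rho>) (\<Sum>n. neumann_term \<rho> z n)"
proof -
  have ne: "z \<noteq> of_real \<rho> * l" if "cmod l < 1" for l
    using mult_strict_left_mono[OF that \<rho>] z \<rho> by (auto simp: norm_mult)
  show ?thesis
    unfolding op_inverses_def
    by (intro conjI; rule has_symbol_unique[OF has_symbol_compose has_symbol_id])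
       (use has_symbol_neumann[OF assms] has_symbol_shifted ne in \<open>auto\<close>)
qed

lemma resolvent_scaled_shift:
  assumes "\<rho> > 0" "\<rho> < cmod z"
  shows "resolvent (scaled_shift \<rho>) z = (\<Sum>n. neumann_term \<rho> z n)"
  unfolding resolvent_def using op_inverses_neumann[OF assms] op_inverses_unique
  by (intro the_equality)

lemma norm_geom: "cmod l < 1 \<Longrightarrow> 1 \<le> norm (geom l)"
  using c0_nth_le_norm[of "geom l" 0] by (simp add: c0_nth_geom)

lemma norm_geom_le: "cmod l < 1 \<Longrightarrow> norm (geom l) \<le> 1"
  by (rule norm_c0_le) (simp add: c0_nth_geom norm_power power_le_one)

text \<open>
  Every point of the open disc is an eigenvalue. A point \<open>z\<close> of the boundary is not, but the unit
  eigenvectors for eigenvalues \<open>w\<close> close to \<open>z\<close> are nearly annihilated by \<open>z - \<rho> B\<close>, so that an inverse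
  would have norm at least \<open>1 / |z - w|\<close>.
\<close>
lemma spectrum_scaled_shift:
  assumes \<rho>: "\<rho> > 0"
  shows "spectrum (scaled_shift \<rho>) = cball 0 \<rho>"
proof (intro set_eqI iffI)
  fix z assume "z \<in> spectrum (scaled_shift \<rho>)"
  then show "z \<in> cball 0 \<rho>"
    using op_inverses_neumann[OF \<rho>, of z] by (force simp: spectrum_def not_less)
next
  fix z :: complex assume "z \<in> cball 0 \<rho>"
  then have "z \<in> closure (ball 0 \<rho>)" using \<rho> by simp
  show "z \<in> spectrum (scaled_shift \<rho>)"
  proof (rule ccontr)
    assume "z \<notin> spectrum (scaled_shift \<rho>)"
    then obtain R where "op_inverses (z *\<^sub>C id_blinfun - scaled_shift \<rho>) R"
      by (auto simp: spectrum_def)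
    then have R: "R o\<^sub>L (z *\<^sub>C id_blinfun - scaled_shift \<rho>) = id_blinfun"
      by (simp add: op_inverses_def)
    have "norm R + 1 > 0" using norm_ge_zero[of R] by linarith
    then obtain w where w: "w \<in> ball 0 \<rho>" "dist w z < 1 / (norm R + 1)"
      using \<open>z \<in> closure (ball 0 \<rho>)\<close> unfolding closure_approachable by (meson divide_pos_pos zero_less_one)
    define l where "l = w / of_real \<rho>"
    have l: "cmod l < 1" "w = of_real \<rho> * l" using w(1) \<rho> by (auto simp: l_def norm_divide)
    have "geom l = R ((z *\<^sub>C id_blinfun - scaled_shift \<rho>) (geom l))"
      using R by (metis blinfun_apply_blinfun_compose id_blinfun.rep_eq)
    also have "(z *\<^sub>C id_blinfun - scaled_shift \<rho>) (geom l) = (z - w) *\<^sub>C geom l"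
      using has_symbol_geom[OF has_symbol_shifted l(1)] l(2) by simp
    finally have "norm (geom l) \<le> norm R * norm ((z - w) *\<^sub>C geom l)"
      by (metis norm_blinfun)
    also have "\<dots> \<le> norm R * (cmod (z - w) * 1)"
      unfolding norm_scaleC using norm_geom_le[OF l(1)] by (intro mult_left_mono) auto
    finally have "1 \<le> norm R * cmod (z - w)" using norm_geom[OF l(1)] by simp
    also have "\<dots> \<le> (norm R + 1) * cmod (z - w)" by (intro mult_right_mono) auto
    finally show False
      using w(2) \<open>norm R + 1 > 0\<close> by (simp add: dist_norm norm_minus_commute field_simps)
  qed
qed

section \<open>The Riesz--Dunford integral\<close>

text \<open>
  The Neumann series of \<open>f(z) (z - \<rho> B)\<^sup>-\<^sup>1\<close> is integrated term by term: its coefficients are scalar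
  holomorphic functions, which have primitives on a disc, and it converges uniformly when the disc keeps a
  positive distance from the spectrum.
\<close>
lemma resolvent_local_primitive:
  assumes \<rho>: "\<rho> > 0" and "open U" and f: "f holomorphic_on U"
    and c: "c \<in> U" "\<rho> < cmod c"
  obtains r F where "r > 0"
    and "\<And>z. z \<in> ball c r \<Longrightarrow>
      (F has_derivative (\<lambda>h. (h * f z) *\<^sub>C resolvent (scaled_shift \<rho>) z)) (at z)"
proof -
  let ?A = "scaled_shift \<rho>"
  obtain r0 where r0: "r0 > 0" "cball c r0 \<subseteq> U"
    using \<open>open U\<close> c(1) by (auto simp: open_contains_cball)
  define r where "r = min r0 ((cmod c - \<rho>) / 2)"
  define q where "q = cmod c - r"
  have r: "r > 0" "cball c r \<subseteq> U" using r0 c(2) by (auto simp: r_def)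
  have q: "\<rho> < q" using c(2) by (auto simp: q_def r_def min_def field_simps)
  have qz: "q \<le> cmod z" if "z \<in> ball c r" for z
    using that norm_triangle_ineq2[of c z] by (simp add: q_def dist_norm)
  have zne: "z \<noteq> 0" if "z \<in> ball c r" for z using qz[OF that] q \<rho> by auto
  obtain K where K: "\<And>z. z \<in> cball c r \<Longrightarrow> cmod (f z) \<le> K"
  proof -
    have "continuous_on (cball c r) f"
      using f r(2) holomorphic_on_imp_continuous_on holomorphic_on_subset by blast
    then have "bounded (f ` cball c r)"
      by (intro compact_imp_bounded compact_continuous_image compact_cball)
    then obtain K where "\<forall>w\<in>f ` cball c r. cmod w \<le> K" unfolding bounded_iff by blast
    then show thesis by (intro that[of K]) blast
  qed
  have "0 \<le> K" using order_trans[OF norm_ge_zero K[of c]] r(1) by simp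
  have "\<exists>G. \<forall>z\<in>ball c r. (G has_field_derivative f z * inverse (z ^ Suc n)) (at z within ball c r)" for n
  proof -
    have "(\<lambda>z. f z * inverse (z ^ Suc n)) holomorphic_on ball c r"
      using r(2) zne by (intro holomorphic_intros holomorphic_on_subset[OF f]) auto
    then obtain H where "\<And>z. z \<in> ball c r \<Longrightarrow>
        (H has_field_derivative f z * inverse (z ^ Suc n)) (at z within ball c r)"
      by (rule holomorphic_convex_primitive'[OF convex_ball open_ball]) (rule that)
    then show ?thesis by (intro exI[of _ H] ballI)
  qed
  then obtain G where G: "\<And>n z. z \<in> ball c r \<Longrightarrow>
      (G n has_field_derivative f z * inverse (z ^ Suc n)) (at z within ball c r)"
    by metis
  define P where "P n z = (G n z - G n c) *\<^sub>C op_power ?A n" for n z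
  define P' where "P' n z h = (h * f z) *\<^sub>C neumann_term \<rho> z n" for n z h
  define R' where "R' z h = (h * f z) *\<^sub>C resolvent ?A z" for z h
  have "\<exists>F. \<forall>z\<in>ball c r. (\<lambda>n. P n z) sums F z \<and> (F has_derivative R' z) (at z within ball c r)"
  proof (rule has_derivative_series)
    fix n z assume z: "z \<in> ball c r"
    have "((\<lambda>z. G n z - G n c) has_derivative (\<lambda>h. f z * inverse (z ^ Suc n) * h)) (at z within ball c r)"
      using has_derivative_diff[OF G[OF z, unfolded has_field_derivative_def] has_derivative_const, of n "G n c"]
      by simp
    from bounded_linear.has_derivative[OF bounded_linear_scaleC_left this, of "op_power ?A n"]
    show "(P n has_derivative P' n z) (at z within ball c r)"
      by (simp add: P_def[abs_def] P'_def[abs_def] neumann_term_def scaleC_scaleC mult_ac)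
  next
    fix e :: real assume e: "e > 0"
    have "uniform_limit (ball c r) (\<lambda>n z. \<Sum>i<n. neumann_term \<rho> z i)
        (\<lambda>z. \<Sum>i. neumann_term \<rho> z i) sequentially"
      by (rule Weierstrass_m_test[OF norm_neumann_term[OF \<rho> qz q] summable_neumann_bound[OF \<rho> q]])
    then have "\<forall>\<^sub>F n in sequentially. \<forall>z\<in>ball c r.
        dist (\<Sum>i<n. neumann_term \<rho> z i) (\<Sum>i. neumann_term \<rho> z i) < e / (K + 1)"
      using e \<open>0 \<le> K\<close> by (intro uniform_limitD) auto
    then show "\<forall>\<^sub>F n in sequentially. \<forall>z\<in>ball c r. \<forall>h.
        norm ((\<Sum>i<n. P' i z h) - R' z h) \<le> e * norm h"
    proof (rule eventually_mono, intro ballI allI)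
      fix n z h
      assume *: "\<forall>z\<in>ball c r. dist (\<Sum>i<n. neumann_term \<rho> z i) (\<Sum>i. neumann_term \<rho> z i) < e / (K + 1)"
        and z: "z \<in> ball c r"
      have res: "resolvent ?A z = (\<Sum>i. neumann_term \<rho> z i)"
        using resolvent_scaled_shift[OF \<rho>, of z] qz[OF z] q by simp
      have "(\<Sum>i<n. P' i z h) - R' z h
          = (h * f z) *\<^sub>C ((\<Sum>i<n. neumann_term \<rho> z i) - (\<Sum>i. neumann_term \<rho> z i))"
        by (simp add: P'_def R'_def res linear_sum[OF bounded_linear.linear[OF bounded_linear_scaleC]]
            linear_diff[OF bounded_linear.linear[OF bounded_linear_scaleC]])
      then have "norm ((\<Sum>i<n. P' i z h) - R' z h)
          = cmod h * cmod (f z) * dist (\<Sum>i<n. neumann_term \<rho> z i) (\<Sum>i. neumann_term \<rho> z i)"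
        by (simp add: norm_scaleC norm_mult dist_norm)
      also have "\<dots> \<le> cmod h * (K + 1) * (e / (K + 1))"
        using * z K[of z] \<open>0 \<le> K\<close> e by (intro mult_mono mult_left_mono) (auto intro: less_imp_le add_increasing2)
      also have "\<dots> = e * norm h" using \<open>0 \<le> K\<close> by simp
      finally show "norm ((\<Sum>i<n. P' i z h) - R' z h) \<le> e * norm h" .
    qed
  next
    show "(\<lambda>n. P n c) sums 0" by (simp add: P_def)
  qed (use r(1) in auto)
  then obtain F where F: "\<And>z. z \<in> ball c r \<Longrightarrow> (F has_derivative R' z) (at z within ball c r)"
    by blast
  have "(F has_derivative (\<lambda>h. (h * f z) *\<^sub>C resolvent ?A z)) (at z)" if "z \<in> ball c r" for z
    using F[OF that] that by (simp add: at_within_open[OF _ open_ball] R'_def[abs_def])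
  with r(1) show thesis by (rule that)
qed

text \<open>
  The derivative of a valid path may be unbounded near the finitely many points where it is undefined,
  so integrability does not follow from piecewise continuity of the integrand. Instead the path is cut
  into pieces on which a local primitive composed with the path is a continuous primitive of the integrand
  up to finitely many points; the fundamental theorem of calculus for the gauge integral then applies.
\<close>
lemma resolvent_path_integrable:
  assumes \<rho>: "\<rho> > 0" and U: "open U" and f: "f holomorphic_on U"
    and g: "valid_path g" "path_image g \<subseteq> U - cball 0 \<rho>"
  shows "(\<lambda>s. (f (g s) * vector_derivative g (at s within {0..1})) *\<^sub>C resolvent (scaled_shift \<rho>) (g s))
           integrable_on {0..1}"
    (is "?I integrable_on _")
proof -
  obtain S D where S: "finite S" and contg: "continuous_on {0..1} g"
    and D: "\<And>s. s \<in> {0..1} - S \<Longrightarrow> (g has_vector_derivative D s) (at s)"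
    using g(1) unfolding valid_path_def piecewise_C1_differentiable_on_def C1_differentiable_on_def
    by blast
  have "?I integrable_on cbox 0 1"
  proof (rule integrable_on_little_subintervals, intro ballI)
    fix t :: real assume "t \<in> cbox 0 1"
    then have t: "t \<in> {0..1}" by simp
    then have "g t \<in> path_image g" by (simp add: path_image_def)
    with g(2) have "g t \<in> U" "\<rho> < cmod (g t)" by auto
    then obtain r F where r: "r > 0" and F: "\<And>z. z \<in> ball (g t) r \<Longrightarrow>
        (F has_derivative (\<lambda>h. (h * f z) *\<^sub>C resolvent (scaled_shift \<rho>) z)) (at z)"
      using resolvent_local_primitive[OF \<rho> U f] by blast
    obtain d where d: "d > 0" "\<And>s. s \<in> {0..1} \<Longrightarrow> dist s t < d \<Longrightarrow> dist (g s) (g t) < r"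
      using contg t r unfolding continuous_on_iff by blast
    have "?I integrable_on cbox u v"
      if uv: "t \<in> cbox u v" "cbox u v \<subseteq> ball t d" "cbox u v \<subseteq> cbox 0 1" for u v
    proof -
      have near: "g s \<in> ball (g t) r" "s \<in> {0..1}" if "s \<in> {u..v}" for s
        using uv that d(2)[of s] by (auto simp: subset_iff dist_commute)
      have "(?I has_integral ((F \<circ> g) v - (F \<circ> g) u)) {u..v}"
      proof (rule fundamental_theorem_of_calculus_interior_strong[OF S])
        show "u \<le> v" using uv(1) by simp
        show "continuous_on {u..v} (F \<circ> g)"
        proof (rule continuous_on_compose)
          show "continuous_on {u..v} g"
            using contg near by (auto intro: continuous_on_subset)
          have "continuous_on (ball (g t) r) F"
            using F by (auto intro!: has_derivative_continuous continuous_at_imp_continuous_on)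
          then show "continuous_on (g ` {u..v}) F"
            by (rule continuous_on_subset) (use near in auto)
        qed
        fix s assume s: "s \<in> {u<..<v} - S"
        then have s': "g s \<in> ball (g t) r" "s \<in> {0..1}" using near[of s] by auto
        have gs: "(g has_vector_derivative D s) (at s)" using D s s'(2) by blast
        have "vector_derivative g (at s within {0..1}) = D s"
          using s'(2) gs by (intro vector_derivative_at_within_ivl) auto
        moreover have "(F \<circ> g has_derivative
            (\<lambda>h. ((h *\<^sub>R D s) * f (g s)) *\<^sub>C resolvent (scaled_shift \<rho>) (g s))) (at s)"
          using diff_chain_at[OF gs[unfolded has_vector_derivative_def] F[OF s'(1)]] by (simp add: o_def)
        ultimately show "(F \<circ> g has_vector_derivative ?I s) (at s)"
          unfolding has_vector_derivative_def
          by (simp add: scaleC_of_real[symmetric] scaleC_scaleC scaleR_conv_of_real mult_ac)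
      qed
      then show ?thesis by (auto simp: integrable_on_def)
    qed
    with d(1) show "\<exists>d>0. \<forall>u v. t \<in> cbox u v \<and> cbox u v \<subseteq> ball t d \<and> cbox u v \<subseteq> cbox 0 1 \<longrightarrow>
        ?I integrable_on cbox u v" by blast
  qed
  then show ?thesis by simp
qed

lemma enlarged_disc:
  fixes \<rho> :: real and U :: "complex set"
  assumes \<rho>: "\<rho> > 0" and U: "open U" "cball 0 \<rho> \<subseteq> U"
  obtains R where "\<rho> < R" "cball 0 R \<subseteq> U"
proof -
  obtain e where e: "e > 0" "(\<Union>x\<in>cball 0 \<rho>. cball x e) \<subseteq> U"
    using compact_subset_open_imp_cball_epsilon_subset[OF compact_cball U] by blast
  define R where "R = \<rho> + e"
  have R: "R > \<rho>" "R > 0" using e \<rho> by (auto simp: R_def)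
  have RU: "cball 0 R \<subseteq> U"
  proof
    fix z :: complex assume z: "z \<in> cball 0 R"
    define p where "p = (\<rho> / R) *\<^sub>R z"
    have "e / R = 1 - \<rho> / R" using R(2) by (simp add: R_def field_simps)
    then have zp: "z - p = (e / R) *\<^sub>R z" by (simp add: p_def scaleR_left_diff_distrib)
    have "cmod p \<le> \<rho>" using z R \<rho> by (simp add: p_def field_simps mult_left_mono)
    moreover have "cmod (z - p) \<le> e" using z R e unfolding zp by (simp add: field_simps mult_left_mono)
    ultimately have "p \<in> cball 0 \<rho>" "z \<in> cball p e" by (auto simp: dist_norm norm_minus_commute)
    then show "z \<in> U" using e(2) by blast
  qed
  from R(1) RU show thesis by (rule that)
qed

lemma surrounding_circle:
  assumes \<rho>: "\<rho> > 0" and U: "open U" "cball 0 \<rho> \<subseteq> U"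
  obtains g where "surrounds_within U (cball 0 \<rho>) g"
proof -
  obtain R where R: "\<rho> < R" and RU: "cball 0 R \<subseteq> U"
    by (rule enlarged_disc[OF assms])
  have "surrounds_within U (cball 0 \<rho>) (circlepath 0 R)"
    unfolding surrounds_within_def
  proof (intro conjI ballI allI impI)
    show "path_image (circlepath 0 R) \<subseteq> U - cball 0 \<rho>"
      using R \<rho> RU by (auto simp: path_image_circlepath_nonneg sphere_def)
    show "winding_number (circlepath 0 R) z = 1" if "z \<in> cball 0 \<rho>" for z
      using that R by (intro winding_number_circlepath) auto
    show "winding_number (circlepath 0 R) z = 0" if "z \<notin> U" for z
      using that R \<rho> RU by (intro winding_number_zero_outside[of _ "cball 0 R"])
        (auto simp: path_image_circlepath_nonneg sphere_def)
  qed auto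
  then show thesis by (rule that)
qed

text \<open>
  On the eigenvector \<open>geom l\<close> the integral is the scalar Cauchy integral of \<open>f\<close> at \<open>\<rho> l\<close>, whose value
  \<open>f(\<rho> l)\<close> is the same for all admissible contours; thus the operator does not depend on the contour
  either. The circle from \<open>surrounding_circle\<close> makes the description unique.
\<close>
theorem has_symbol_riesz_dunford:
  assumes \<rho>: "\<rho> > 0" and U: "open U" "cball 0 \<rho> \<subseteq> U" and f: "f holomorphic_on U"
  shows "has_symbol (riesz_dunford U f (scaled_shift \<rho>)) (\<lambda>l. f (of_real \<rho> * l))"
proof -
  let ?A = "scaled_shift \<rho>"
  let ?sym = "\<lambda>l. f (of_real \<rho> * l)"
  define J where "J g s = (f (g s) * vector_derivative g (at s within {0..1}) / (2 * of_real pi * \<i>))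
      *\<^sub>C resolvent ?A (g s)" for g s
  have ex: "\<exists>B. (J g has_integral B) {0..1} \<and> has_symbol B ?sym"
    if g: "surrounds_within U (cball 0 \<rho>) g" for g
  proof -
    have vg: "valid_path g" "path_image g \<subseteq> U - cball 0 \<rho>"
      and loop: "pathfinish g = pathstart g"
      and wn: "\<And>z. z \<in> cball 0 \<rho> \<Longrightarrow> winding_number g z = 1" "\<And>z. z \<notin> U \<Longrightarrow> winding_number g z = 0"
      using g by (auto simp: surrounds_within_def)
    have hol: "(\<lambda>z. f z / (2 * of_real pi * \<i>)) holomorphic_on U"
      by (intro holomorphic_intros f) auto
    have "J g integrable_on {0..1}"
      using resolvent_path_integrable[OF \<rho> U(1) hol vg] by (simp add: J_def[abs_def])
    then obtain B where B: "(J g has_integral B) {0..1}" by (auto simp: integrable_on_def)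
    have big: "\<rho> < cmod (g s)" if "s \<in> {0..1}" for s
    proof -
      have "g s \<in> path_image g" using that by (simp add: path_image_def)
      with vg(2) show ?thesis by auto
    qed
    have "has_symbol B ?sym"
    proof (rule has_symbol_integral[OF _ B])
      fix s :: real assume s: "s \<in> {0..1}"
      show "has_symbol (J g s) (\<lambda>l. (f (g s) * vector_derivative g (at s within {0..1}) / (2 * of_real pi * \<i>))
          * (1 / (g s - of_real \<rho> * l)))"
        unfolding J_def resolvent_scaled_shift[OF \<rho> big[OF s]]
        by (intro has_symbol_scaleC has_symbol_neumann \<rho> big s)
    next
      fix l :: complex assume l: "cmod l < 1"
      have "\<rho> * cmod l \<le> \<rho>" using l \<rho> by (simp add: mult_left_le)
      then have p: "of_real \<rho> * l \<in> cball 0 \<rho>" using \<rho> by (simp add: norm_mult)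
      have "((\<lambda>w. f w / (2 * of_real pi * \<i>) / (w - of_real \<rho> * l)) has_contour_integral
          (of_real (2 * pi) * \<i> * winding_number g (of_real \<rho> * l) * (?sym l / (2 * of_real pi * \<i>)))) g"
        by (rule Cauchy_integral_formula_global[OF U(1) hol]) (use p U(2) vg loop wn in auto)
      then show "((\<lambda>s. (f (g s) * vector_derivative g (at s within {0..1}) / (2 * of_real pi * \<i>))
          * (1 / (g s - of_real \<rho> * l))) has_integral ?sym l) {0..1}"
        using wn(1)[OF p] by (simp add: has_contour_integral_def mult_ac)
    qed
    with B show ?thesis by blast
  qed
  obtain g0 where g0: "surrounds_within U (cball 0 \<rho>) g0"
    by (rule surrounding_circle[OF \<rho> U])
  obtain B where B: "(J g0 has_integral B) {0..1}" "has_symbol B ?sym"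
    using ex[OF g0] by blast
  have "riesz_dunford U f ?A = B"
    unfolding riesz_dunford_def spectrum_scaled_shift[OF \<rho>] J_def[symmetric]
  proof (rule the_equality)
    show "\<forall>g. surrounds_within U (cball 0 \<rho>) g \<longrightarrow> (J g has_integral B) {0..1}"
      using ex has_symbol_unique[OF B(2)] by blast
    show "B' = B" if "\<forall>g. surrounds_within U (cball 0 \<rho>) g \<longrightarrow> (J g has_integral B') {0..1}" for B'
      using that g0 B(1) has_integral_unique by blast
  qed
  with B(2) show ?thesis by simp
qed

section \<open>Chaos from eigenvalues\<close>

lemma funpow_blinfun: "(blinfun_apply T ^^ k) x = blinfun_apply (op_power T k) x"
  by (induction k) auto

lemma op_power_add: "op_power T (m + n) = op_power T m o\<^sub>L op_power T n"
  by (induction m) (auto intro!: blinfun_eqI)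

text \<open>
  The finitely supported sequences with entries in a countable dense subset of the complex numbers.
\<close>
lemma c0_countable_dense:
  obtains D :: "c0 set" where "countable D" "closure D = UNIV"
proof -
  obtain Q :: "complex set" where Q: "countable Q" "\<And>X. open X \<Longrightarrow> X \<noteq> {} \<Longrightarrow> \<exists>d\<in>Q. d \<in> X"
    using countable_dense_exists by blast
  define comb where "comb L = (\<Sum>j<length L. (L ! j) *\<^sub>C jet 0 j)" for L :: "complex list"
  have "x \<in> closure (comb ` lists Q)" for x
    unfolding closure_approachable
  proof (intro allI impI)
    fix e :: real assume e: "e > 0"
    obtain N where N: "\<And>n. n \<ge> N \<Longrightarrow> cmod (c0_nth x n) < e / 2"
      using LIMSEQ_D[OF c0_nth_tendsto[of x], of "e / 2"] e by auto
    have "\<exists>q\<in>Q. q \<in> ball (c0_nth x n) (e / 2)" for n using Q(2)[of "ball (c0_nth x n) (e / 2)"] e by auto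
    then obtain q where q: "\<And>n. q n \<in> Q" "\<And>n. dist (c0_nth x n) (q n) < e / 2"
      unfolding mem_ball by metis
    have "comb (map q [0..<N]) = (\<Sum>j<N. q j *\<^sub>C jet 0 j)"
      unfolding comb_def by (rule sum.cong) auto
    then have "norm (comb (map q [0..<N]) - x) \<le> e / 2"
      using N q(2) e
      by (intro norm_c0_le) (auto simp: c0_nth_finite_combination dist_norm norm_minus_commute
          simp del: c0_nth_sum intro: less_imp_le)
    then have "dist (comb (map q [0..<N])) x < e" using e by (simp add: dist_norm)
    moreover have "comb (map q [0..<N]) \<in> comb ` lists Q" using q(1) by (intro imageI) (auto simp: in_lists_conv_set)
    ultimately show "\<exists>y\<in>comb ` lists Q. dist y x < e" by blast
  qed
  then show thesis
    using countable_image[OF countable_lists[OF Q(1)]] by (intro that[of "comb ` lists Q"]) auto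
qed

text \<open>
  If \<open>T\<^sup>n x \<longlonglongrightarrow> 0\<close>, \<open>u\<^sub>n \<longlonglongrightarrow> 0\<close> and \<open>T\<^sup>n u\<^sub>n = y\<close>, then \<open>x + u\<^sub>n\<close> is close to \<open>x\<close> while its \<open>n\<close>-th
  iterate is close to \<open>y\<close>. So the points whose orbit meets a given ball form a dense open set, and by
  Baire's theorem some point has an orbit that meets all balls of a countable base.
\<close>
lemma dense_orbit_criterion:
  fixes T :: "c0 \<Rightarrow>\<^sub>L c0"
  assumes X: "closure {x. (\<lambda>n. blinfun_apply (op_power T n) x) \<longlonglongrightarrow> 0} = UNIV"
    and Y: "closure {y. \<exists>u. u \<longlonglongrightarrow> 0 \<and> (\<forall>n. blinfun_apply (op_power T n) (u n) = y)} = UNIV"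
  shows "\<exists>x. closure (range (\<lambda>k. (blinfun_apply T ^^ k) x)) = UNIV"
proof -
  obtain D :: "c0 set" where D: "countable D" "closure D = UNIV"
    by (rule c0_countable_dense)
  define V where "V d m = (\<Union>k. blinfun_apply (op_power T k) -` ball d (inverse (Suc m)))" for d and m :: nat
  have open_V: "open (V d m)" for d m
    unfolding V_def by (intro open_UN ballI open_vimage open_ball linear_continuous_on blinfun.bounded_linear_right)
  have dense_V: "closure (V d m) = UNIV" for d m
  proof (intro set_eqI iffI UNIV_I)
    fix x :: c0
    show "x \<in> closure (V d m)"
      unfolding closure_approachable
    proof (intro allI impI)
      fix e :: real assume e: "e > 0"
      define \<delta> where "\<delta> = inverse (real (Suc m))"
      have \<delta>: "\<delta> > 0" by (simp add: \<delta>_def)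
      have "x \<in> closure {x. (\<lambda>n. blinfun_apply (op_power T n) x) \<longlonglongrightarrow> 0}" using X by simp
      then obtain x0 where x0: "(\<lambda>n. blinfun_apply (op_power T n) x0) \<longlonglongrightarrow> 0" "dist x0 x < e / 2"
        unfolding closure_approachable using half_gt_zero[OF e] by blast
      have "d \<in> closure {y. \<exists>u. u \<longlonglongrightarrow> 0 \<and> (\<forall>n. blinfun_apply (op_power T n) (u n) = y)}" using Y by simp
      then obtain y0 u where u: "u \<longlonglongrightarrow> 0" "\<And>n. blinfun_apply (op_power T n) (u n) = y0" "dist y0 d < \<delta> / 2"
        unfolding closure_approachable using half_gt_zero[OF \<delta>] by blast
      have "\<forall>\<^sub>F n in sequentially. dist (blinfun_apply (op_power T n) x0) 0 < \<delta> / 2"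
        by (rule tendstoD[OF x0(1) half_gt_zero[OF \<delta>]])
      moreover have "\<forall>\<^sub>F n in sequentially. dist (u n) 0 < e / 2"
        by (rule tendstoD[OF u(1) half_gt_zero[OF e]])
      ultimately have "\<forall>\<^sub>F n in sequentially. dist (blinfun_apply (op_power T n) x0) 0 < \<delta> / 2 \<and> dist (u n) 0 < e / 2"
        by (rule eventually_conj)
      then obtain n where n: "norm (blinfun_apply (op_power T n) x0) < \<delta> / 2" "norm (u n) < e / 2"
        by (auto simp: eventually_sequentially)
      have "dist (x0 + u n) x \<le> dist x0 x + norm (u n)"
        unfolding dist_norm by norm
      then have "dist (x0 + u n) x < e" using x0(2) n(2) by linarith
      moreover have "dist d (blinfun_apply (op_power T n) (x0 + u n)) < \<delta>"
      proof -
        have "dist d (blinfun_apply (op_power T n) x0 + y0) \<le> norm (blinfun_apply (op_power T n) x0) + dist y0 d"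
          unfolding dist_norm by norm
        then show ?thesis using n(1) u(2,3) by (simp add: blinfun.add_right)
      qed
      then have "x0 + u n \<in> V d m" by (auto simp: V_def \<delta>_def)
      ultimately show "\<exists>y\<in>V d m. dist y x < e" by blast
    qed
  qed
  have "Met_TC.mtopology closure_of \<Inter>((\<lambda>(d, m). V d m) ` (D \<times> UNIV)) = UNIV"
    using D(1) open_V dense_V
    by (intro Met_TC.metric_Baire_category) (auto simp: euclidean_closure_of)
  then have "\<Inter>((\<lambda>(d, m). V d m) ` (D \<times> UNIV)) \<noteq> {}" by (auto simp: euclidean_closure_of)
  then obtain x where x: "\<And>d m. d \<in> D \<Longrightarrow> x \<in> V d m" by blast
  have "y \<in> closure (range (\<lambda>k. (blinfun_apply T ^^ k) x))" for y
    unfolding closure_approachable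
  proof (intro allI impI)
    fix e :: real assume e: "e > 0"
    obtain m where m: "inverse (real (Suc m)) < e / 2" using reals_Archimedean[OF half_gt_zero[OF e]] by blast
    have "y \<in> closure D" using D(2) by simp
    then obtain d where d: "d \<in> D" "dist d y < e / 2"
      unfolding closure_approachable using half_gt_zero[OF e] by blast
    obtain k where "dist d (blinfun_apply (op_power T k) x) < inverse (Suc m)"
      using x[OF d(1), of m] by (auto simp: V_def)
    then have "dist ((blinfun_apply T ^^ k) x) y < e"
      using m d(2) dist_triangle3[of "(blinfun_apply T ^^ k) x" y d] by (simp add: funpow_blinfun)
    then show "\<exists>z\<in>range (\<lambda>k. (blinfun_apply T ^^ k) x). dist z y < e" by blast
  qed
  then show ?thesis by blast
qed

definition chaotic_operator :: "(c0 \<Rightarrow>\<^sub>L c0) \<Rightarrow> bool" where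
  "chaotic_operator T \<longleftrightarrow>
     (\<exists>x. closure (range (\<lambda>k. (blinfun_apply T ^^ k) x)) = UNIV) \<and>
     closure {x. \<exists>k>0. (blinfun_apply T ^^ k) x = x} = UNIV"

lemma op_power_fixed_mult:
  assumes "blinfun_apply (op_power T k) x = x"
  shows "blinfun_apply (op_power T (m * k)) x = x"
  using assms by (induction m) (auto simp: op_power_add)

text \<open>
  The Godefroy--Shapiro criterion. The vectors with \<open>T\<^sup>n x \<longlonglongrightarrow> 0\<close>, those with preimages \<open>u\<^sub>n \<longlonglongrightarrow> 0\<close> under
  \<open>T\<^sup>n\<close>, and the periodic ones form three subspaces, and each contains a total set of eigenvectors.
\<close>
theorem chaotic_operator_criterion:
  assumes T: "has_symbol T h" and l: "cmod l < 1"
    and small: "l islimpt {x. cmod x < 1 \<and> cmod (h x) < 1}"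
    and large: "l islimpt {x. cmod x < 1 \<and> 1 < cmod (h x)}"
    and root: "l islimpt {x. cmod x < 1 \<and> (\<exists>k>0. h x ^ k = 1)}"
  shows "chaotic_operator T"
  unfolding chaotic_operator_def
proof (intro conjI dense_orbit_criterion)
  note P = has_symbol_op_power[OF T]
  note lin = bounded_linear_scaleC
  let ?X = "{x. (\<lambda>n. blinfun_apply (op_power T n) x) \<longlonglongrightarrow> 0}"
  show "closure ?X = UNIV"
  proof (rule dense_csubspace[OF _ l])
    show "csubspace ?X"
    proof (rule csubspaceI)
      show "x + y \<in> ?X" if "x \<in> ?X" "y \<in> ?X" for x y
        using that tendsto_add[of "\<lambda>n. blinfun_apply (op_power T n) x" 0 sequentially
            "\<lambda>n. blinfun_apply (op_power T n) y" 0] by (simp add: blinfun.add_right)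
      show "c *\<^sub>C x \<in> ?X" if "x \<in> ?X" for c x
        using that bounded_linear.tendsto[OF lin, of "\<lambda>n. blinfun_apply (op_power T n) x" 0 sequentially c]
        by (simp add: has_symbol_clinear[OF P] scaleC_zero_right)
    qed simp
    have "geom x \<in> ?X" if "cmod x < 1" "cmod (h x) < 1" for x
      using bounded_linear.tendsto[OF bounded_linear_scaleC_left LIMSEQ_power_zero[OF that(2)], of "geom x"]
      by (simp add: has_symbol_geom[OF P that(1)])
    then show "l islimpt {x. cmod x < 1 \<and> geom x \<in> ?X}"
      by (intro islimpt_subset[OF small]) auto
  qed
  let ?Y = "{y. \<exists>u. u \<longlonglongrightarrow> 0 \<and> (\<forall>n. blinfun_apply (op_power T n) (u n) = y)}"
  show "closure ?Y = UNIV"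
  proof (rule dense_csubspace[OF _ l])
    show "csubspace ?Y"
    proof (rule csubspaceI)
      show "0 \<in> ?Y" by (auto intro!: exI[of _ "\<lambda>_. 0"])
    next
      fix x y assume "x \<in> ?Y" "y \<in> ?Y"
      then obtain u v where "u \<longlonglongrightarrow> 0" "\<And>n. blinfun_apply (op_power T n) (u n) = x"
        "v \<longlonglongrightarrow> 0" "\<And>n. blinfun_apply (op_power T n) (v n) = y" by blast
      then show "x + y \<in> ?Y"
        using tendsto_add[of u 0 sequentially v 0]
        by (auto intro!: exI[of _ "\<lambda>n. u n + v n"] simp: blinfun.add_right)
    next
      fix c x assume "x \<in> ?Y"
      then obtain u where u: "u \<longlonglongrightarrow> 0" "\<And>n. blinfun_apply (op_power T n) (u n) = x" by blast
      then show "c *\<^sub>C x \<in> ?Y"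
        using bounded_linear.tendsto[OF lin u(1), of c]
        by (auto intro!: exI[of _ "\<lambda>n. c *\<^sub>C u n"] simp: has_symbol_clinear[OF P] scaleC_zero_right)
    qed
    have "geom x \<in> ?Y" if x: "cmod x < 1" "1 < cmod (h x)" for x
    proof -
      have "cmod (inverse (h x)) < 1" using x(2) by (simp only: norm_inverse inverse_less_1_iff) simp
      from bounded_linear.tendsto[OF bounded_linear_scaleC_left LIMSEQ_power_zero[OF this], of "geom x"]
      have "(\<lambda>n. inverse (h x) ^ n *\<^sub>C geom x) \<longlonglongrightarrow> 0" by simp
      moreover have "h x \<noteq> 0" using x(2) by auto
      then have "blinfun_apply (op_power T n) (inverse (h x) ^ n *\<^sub>C geom x) = geom x" for n
        by (simp add: has_symbol_clinear[OF P] has_symbol_geom[OF P x(1)] scaleC_scaleC scaleC_one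
            flip: power_mult_distrib)
      ultimately show ?thesis by blast
    qed
    then show "l islimpt {x. cmod x < 1 \<and> geom x \<in> ?Y}"
      by (intro islimpt_subset[OF large]) blast
  qed
  let ?Z = "{x. \<exists>k>0. (blinfun_apply T ^^ k) x = x}"
  show "closure ?Z = UNIV"
  proof (rule dense_csubspace[OF _ l])
    show "csubspace ?Z"
    proof (rule csubspaceI)
      show "0 \<in> ?Z" by (auto simp: funpow_blinfun)
    next
      fix x y assume "x \<in> ?Z" "y \<in> ?Z"
      then obtain j k where jk: "j > 0" "blinfun_apply (op_power T j) x = x"
        "k > 0" "blinfun_apply (op_power T k) y = y" by (auto simp: funpow_blinfun)
      have "blinfun_apply (op_power T (j * k)) (x + y) = x + y"
        using op_power_fixed_mult[OF jk(2), of k] op_power_fixed_mult[OF jk(4), of j]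
        by (simp add: blinfun.add_right mult.commute)
      then show "x + y \<in> ?Z" using jk by (auto simp: funpow_blinfun intro!: exI[of _ "j * k"])
    next
      fix c x assume "x \<in> ?Z"
      then show "c *\<^sub>C x \<in> ?Z" by (auto simp: funpow_blinfun has_symbol_clinear[OF P])
    qed
    have "geom x \<in> ?Z" if "cmod x < 1" "k > 0" "h x ^ k = 1" for x k
      using that by (auto simp: funpow_blinfun has_symbol_geom[OF P] scaleC_one intro!: exI[of _ k])
    then show "l islimpt {x. cmod x < 1 \<and> geom x \<in> ?Z}"
      by (intro islimpt_subset[OF root]) blast
  qed
qed

text \<open>
  Since \<open>\<phi>\<close> is open, the image of every neighbourhood of \<open>l\<close> is a neighbourhood of \<open>\<phi> l\<close>.
\<close>
lemma islimpt_vimage_holomorphic: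
  assumes \<phi>: "\<phi> holomorphic_on ball 0 1" "\<not> \<phi> constant_on ball 0 1"
    and l: "cmod l < 1" and lim: "\<phi> l islimpt P"
  shows "l islimpt {x. cmod x < 1 \<and> \<phi> x \<in> P}"
proof (rule islimptI)
  fix S assume S: "l \<in> S" "open S"
  have "open (\<phi> ` (S \<inter> ball 0 1))"
    using \<phi> S by (intro open_mapping_thm[of \<phi> "ball 0 1"]) auto
  moreover have "\<phi> l \<in> \<phi> ` (S \<inter> ball 0 1)" using S l by auto
  ultimately have "\<exists>p\<in>P. p \<in> \<phi> ` (S \<inter> ball 0 1) \<and> p \<noteq> \<phi> l"
    using lim unfolding islimpt_def by (elim allE[of _ "\<phi> ` (S \<inter> ball 0 1)"]) (rule mp, rule mp)
  then show "\<exists>y\<in>{x. cmod x < 1 \<and> \<phi> x \<in> P}. y \<in> S \<and> y \<noteq> l" by auto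
qed

text \<open>
  The first two sets are the open left and right half-planes. The third one contains the points
  \<open>2 \<pi> \<i> r / t\<close> with rational \<open>r\<close>, which are dense in the imaginary axis.
\<close>
lemma imaginary_islimpt:
  assumes t: "t > 0" and w: "Re w = 0"
  shows "w islimpt {z. cmod (exp (of_real t * z)) < 1}"
    and "w islimpt {z. 1 < cmod (exp (of_real t * z))}"
    and "w islimpt {z. \<exists>k>0. exp (of_real t * z) ^ k = 1}"
proof -
  show "w islimpt {z. cmod (exp (of_real t * z)) < 1}"
    unfolding islimpt_approachable
  proof (intro allI impI)
    fix e :: real assume "e > 0"
    then show "\<exists>x\<in>{z. cmod (exp (of_real t * z)) < 1}. x \<noteq> w \<and> dist x w < e"
      using t w by (intro bexI[of _ "w - of_real (e / 2)"]) (auto simp: dist_norm norm_exp_eq_Re)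
  qed
  show "w islimpt {z. 1 < cmod (exp (of_real t * z))}"
    unfolding islimpt_approachable
  proof (intro allI impI)
    fix e :: real assume "e > 0"
    then show "\<exists>x\<in>{z. 1 < cmod (exp (of_real t * z))}. x \<noteq> w \<and> dist x w < e"
      using t w by (intro bexI[of _ "w + of_real (e / 2)"]) (auto simp: dist_norm norm_exp_eq_Re)
  qed
  show "w islimpt {z. \<exists>k>0. exp (of_real t * z) ^ k = 1}"
    unfolding islimpt_approachable
  proof (intro allI impI)
    fix e :: real assume e: "e > 0"
    \<comment> \<open>With this scaling, \<open>\<i> r / a\<close> is the point \<open>2 \<pi> \<i> r / t\<close>.\<close>
    define a where "a = t / (2 * pi)"
    have a: "a > 0" using t by (simp add: a_def)
    have "a * Im w < a * (Im w + e)" using a e by simp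
    then obtain r where r: "r \<in> \<rat>" "a * Im w < r" "r < a * (Im w + e)"
      using Rats_dense_in_real by blast
    then obtain i :: int and k :: nat where k: "r = of_int i / of_nat k" "k \<noteq> 0"
      by (auto simp: Rats_eq_int_div_nat)
    define z where "z = \<i> * of_real (r / a)"
    define \<delta> where "\<delta> = r / a - Im w"
    have wz: "z - w = \<i> * of_real \<delta>"
      using w by (simp add: complex_eq_iff z_def \<delta>_def)
    have \<delta>: "0 < \<delta>" "\<delta> < e" using r a by (auto simp: \<delta>_def field_simps)
    then have "cmod (z - w) < e" unfolding wz by (simp add: norm_mult)
    moreover have "z \<noteq> w" using wz \<delta>(1) by auto
    moreover have "exp (of_real t * z) ^ k = 1"
    proof -
      have "real k * (t * (r / a)) = 2 * of_int i * pi"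
        using k t by (simp add: a_def field_simps)
      moreover have "of_nat k * (of_real t * z) = of_real (real k * (t * (r / a))) * \<i>"
        by (simp add: z_def)
      ultimately have "of_nat k * (of_real t * z) = of_real (2 * of_int i * pi) * \<i>"
        by (simp only:)
      moreover have "exp (of_real (2 * of_int i * pi) * \<i>) = (1::complex)"
        using exp_integer_2pi[of "of_int i"] by (simp add: mult_ac)
      ultimately show ?thesis by (metis exp_of_nat_mult)
    qed
    ultimately show "\<exists>x\<in>{z. \<exists>k>0. exp (of_real t * z) ^ k = 1}. x \<noteq> w \<and> dist x w < e"
      using k(2) by (intro bexI[of _ z]) (auto simp: dist_norm)
  qed
qed

theorem chaotic_exponential:
  assumes T: "has_symbol T (\<lambda>l. exp (of_real t * \<phi> l))" and t: "t > 0"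
    and \<phi>: "\<phi> holomorphic_on ball 0 1" "\<not> \<phi> constant_on ball 0 1"
    and l: "cmod l < 1" "Re (\<phi> l) = 0"
  shows "chaotic_operator T"
  using imaginary_islimpt[OF t l(2), THEN islimpt_vimage_holomorphic[OF \<phi> l(1)]]
  by (intro chaotic_operator_criterion[OF T l(1)]) simp_all

section \<open>Absence of periodic points\<close>

text \<open>
  A sequence in the kernel satisfies \<open>\<rho> x\<^bsub>n+1\<^esub> = \<zeta> x\<^sub>n\<close>, so it has constant modulus, and it tends to 0.
\<close>
lemma shift_minus_boundary_injective:
  assumes \<rho>: "\<rho> > 0" and \<zeta>: "cmod \<zeta> = \<rho>"
    and x: "blinfun_apply (scaled_shift \<rho> - \<zeta> *\<^sub>C id_blinfun) x = 0"
  shows "x = 0"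
proof -
  have step: "of_real \<rho> * c0_nth x (Suc n) = \<zeta> * c0_nth x n" for n
    using arg_cong[OF x, of "\<lambda>y. c0_nth y n"] by (simp add: blinfun.diff_left)
  have "cmod (c0_nth x (Suc n)) = cmod (c0_nth x n)" for n
    using arg_cong[OF step[of n], of cmod] \<zeta> \<rho> by (simp add: norm_mult)
  then have const: "cmod (c0_nth x n) = cmod (c0_nth x 0)" for n
    by (induction n) auto
  have "(\<lambda>n. cmod (c0_nth x n)) \<longlonglongrightarrow> 0"
    using c0_nth_tendsto[of x] by (rule tendsto_norm_zero)
  moreover have "(\<lambda>n. cmod (c0_nth x n)) = (\<lambda>_. cmod (c0_nth x 0))"
    using const by (rule ext)
  ultimately have "cmod (c0_nth x 0) = 0" by (metis LIMSEQ_const_iff)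
  with const have "c0_nth x n = 0" for n by (metis norm_eq_zero)
  then show "x = 0" by (intro c0_eqI) simp
qed

lemma op_power_injective:
  assumes "\<And>x. blinfun_apply A x = 0 \<Longrightarrow> x = 0" "blinfun_apply (op_power A n) x = 0"
  shows "x = 0"
  using assms(2) by (induction n) (auto dest: assms(1))

text \<open>
  The local factorisation at \<open>\<zeta>\<close> and the quotient \<open>g z / (z - \<zeta>)\<^sup>n\<close> away from \<open>\<zeta>\<close> agree where both are
  defined, so they glue to a holomorphic function on all of \<open>U\<close>, which may be disconnected.
\<close>
lemma holomorphic_factor_zero_global:
  assumes g: "g holomorphic_on U" and U: "open U"
    and S: "open S" "connected S" "S \<subseteq> U" and \<zeta>: "\<zeta> \<in> S" "g \<zeta> = 0"
    and w: "w \<in> S" "g w \<noteq> 0"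
  obtains n h where "h holomorphic_on U" "h \<zeta> \<noteq> 0" "\<And>z. z \<in> U \<Longrightarrow> g z = (z - \<zeta>) ^ n * h z"
proof -
  have "\<not> g constant_on S" using \<zeta> w unfolding constant_on_def by metis
  then obtain k r n where r: "0 < r" "ball \<zeta> r \<subseteq> S" and k: "k holomorphic_on ball \<zeta> r"
      "\<And>w. w \<in> ball \<zeta> r \<Longrightarrow> g w = (w - \<zeta>) ^ n * k w" "\<And>w. w \<in> ball \<zeta> r \<Longrightarrow> k w \<noteq> 0"
    using holomorphic_factor_zero_nonconstant[OF holomorphic_on_subset[OF g S(3)] S(1,2) \<zeta>] by metis
  define h where "h z = (if z \<in> ball \<zeta> r then k z else g z / (z - \<zeta>) ^ n)" for z
  have h2: "h z = g z / (z - \<zeta>) ^ n" if "z \<noteq> \<zeta>" for z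
    using that k(2)[of z] by (simp add: h_def)
  have "h holomorphic_on ball \<zeta> r"
    using k(1) by (rule holomorphic_transform) (simp add: h_def)
  moreover have "h holomorphic_on (U - {\<zeta>})"
  proof (rule holomorphic_transform)
    show "(\<lambda>z. g z / (z - \<zeta>) ^ n) holomorphic_on (U - {\<zeta>})"
      by (intro holomorphic_intros holomorphic_on_subset[OF g]) auto
  qed (use h2 in auto)
  ultimately have "h holomorphic_on ball \<zeta> r \<union> (U - {\<zeta>})"
    using U by (intro holomorphic_on_Un) (auto intro: open_delete)
  moreover have "ball \<zeta> r \<union> (U - {\<zeta>}) = U" using r S(3) by auto
  ultimately have "h holomorphic_on U" by simp
  moreover have "h \<zeta> \<noteq> 0" using k(3) r(1) by (simp add: h_def)
  moreover have "g z = (z - \<zeta>) ^ n * h z" if "z \<in> U" for z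
    using h2[of z] k(2)[of \<zeta>] r(1) by (cases "z = \<zeta>") (auto simp: h_def)
  ultimately show thesis by (rule that)
qed

text \<open>
  Infinitely many zeros would accumulate in the closed disc, and \<open>g\<close> would vanish on the slightly larger
  disc on which it is holomorphic.
\<close>
lemma finite_zeros_closed_disc:
  assumes \<rho>: "\<rho> > 0" and U: "open U" "cball 0 \<rho> \<subseteq> U" and g: "g holomorphic_on U"
    and nz: "\<And>z. z \<in> ball 0 \<rho> \<Longrightarrow> g z \<noteq> 0"
  shows "finite {z \<in> cball 0 \<rho>. g z = 0}" (is "finite ?Z")
proof (rule ccontr)
  assume "infinite ?Z"
  moreover have "?Z \<subseteq> cball 0 \<rho>" by blast
  ultimately obtain \<xi> where \<xi>: "\<xi> \<in> cball 0 \<rho>" "\<xi> islimpt ?Z"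
    using Heine_Borel_imp_Bolzano_Weierstrass[OF compact_cball] by blast
  obtain R where R: "\<rho> < R" "cball 0 R \<subseteq> U" by (rule enlarged_disc[OF \<rho> U])
  then have "ball 0 R \<subseteq> U" by (meson ball_subset_cball order_trans)
  have "g 0 = 0"
  proof (rule analytic_continuation[of g "ball 0 R" ?Z \<xi>])
    show "g holomorphic_on ball 0 R" by (rule holomorphic_on_subset[OF g]) fact
  qed (use \<xi> R \<rho> in auto)
  then show False using nz[of 0] \<rho> by simp
qed

text \<open>
  Induction on the number of zeros in the closed disc, all of which lie on the boundary circle. Without
  zeros, \<open>1 / g\<close> is the symbol of an inverse. Otherwise a zero \<open>\<zeta>\<close> is divided out with its full
  multiplicity, and the operator is a power of \<open>\<rho> B - \<zeta>\<close> times one with fewer zeros.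
\<close>
theorem symbol_injective:
  assumes \<rho>: "\<rho> > 0" and U: "open U" "cball 0 \<rho> \<subseteq> U" and g: "g holomorphic_on U"
    and nz: "\<And>z. z \<in> ball 0 \<rho> \<Longrightarrow> g z \<noteq> 0"
    and G: "has_symbol G (\<lambda>l. g (of_real \<rho> * l))" and x: "blinfun_apply G x = 0"
  shows "x = 0"
  using g nz G x
proof (induction "card {z \<in> cball 0 \<rho>. g z = 0}" arbitrary: g G x rule: less_induct)
  case less
  note g = less.prems(1) and nz = less.prems(2) and G = less.prems(3)
  let ?Z = "\<lambda>g. {z \<in> cball 0 \<rho>. g z = (0::complex)}"
  have fin: "finite (?Z g)" by (rule finite_zeros_closed_disc[OF \<rho> U g nz])
  have in_ball: "of_real \<rho> * l \<in> ball 0 \<rho>" if "cmod l < 1" for l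
    using that \<rho> by (simp add: norm_mult)
  show ?case
  proof (cases "?Z g = {}")
    case True
    \<comment> \<open>The reciprocal is only holomorphic off the zeros that \<open>g\<close> may have outside the disc.\<close>
    define V where "V = U \<inter> g -` (- {0})"
    have V: "open V" "cball 0 \<rho> \<subseteq> V" "V \<subseteq> U"
      using True U continuous_open_preimage[OF holomorphic_on_imp_continuous_on[OF g] U(1), of "- {0}"]
      by (auto simp: V_def)
    have "(\<lambda>z. inverse (g z)) holomorphic_on V"
      by (intro holomorphic_intros holomorphic_on_subset[OF g V(3)]) (auto simp: V_def)
    from has_symbol_riesz_dunford[OF \<rho> V(1,2) this]
    obtain K where K: "has_symbol K (\<lambda>l. inverse (g (of_real \<rho> * l)))" by blast
    have "K o\<^sub>L G = id_blinfun"
      using nz in_ball by (intro has_symbol_unique[OF has_symbol_compose[OF K G] has_symbol_id]) simp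
    then have "x = blinfun_apply K (blinfun_apply G x)"
      by (metis blinfun_apply_blinfun_compose blinfun_apply_id_blinfun)
    then show ?thesis using less.prems(4) by simp
  next
    case False
    then obtain \<zeta> where \<zeta>: "\<zeta> \<in> cball 0 \<rho>" "g \<zeta> = 0" by blast
    have "cmod \<zeta> = \<rho>" using \<zeta> nz[of \<zeta>] by force
    obtain R where R: "\<rho> < R" "cball 0 R \<subseteq> U" by (rule enlarged_disc[OF \<rho> U])
    then have RU: "ball 0 R \<subseteq> U" by (meson ball_subset_cball order_trans)
    have "\<zeta> \<in> ball 0 R" "0 \<in> ball 0 R" "g 0 \<noteq> 0" using \<zeta>(1) R(1) \<rho> nz[of 0] by auto
    then obtain n h where h: "h holomorphic_on U" "h \<zeta> \<noteq> 0"
        "\<And>z. z \<in> U \<Longrightarrow> g z = (z - \<zeta>) ^ n * h z"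
      using holomorphic_factor_zero_global[OF g U(1) open_ball connected_ball RU _ \<zeta>(2)] by metis
    have gh: "g z = (z - \<zeta>) ^ n * h z" if "z \<in> cball 0 \<rho>" for z
      using h(3) that U(2) by blast
    have "?Z h \<subset> ?Z g" using gh h(2) \<zeta> by auto
    then have card: "card (?Z h) < card (?Z g)" by (rule psubset_card_mono[OF fin])
    have nzh: "h z \<noteq> 0" if "z \<in> ball 0 \<rho>" for z
      using nz[OF that] gh[of z] that by auto
    obtain H where H: "has_symbol H (\<lambda>l. h (of_real \<rho> * l))"
      using has_symbol_riesz_dunford[OF \<rho> U h(1)] by blast
    let ?B = "scaled_shift \<rho> - \<zeta> *\<^sub>C id_blinfun"
    have B: "has_symbol ?B (\<lambda>l. of_real \<rho> * l - \<zeta> * 1)"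
      by (intro has_symbol_diff has_symbol_scaled_shift has_symbol_scaleC has_symbol_id)
    have "G = op_power ?B n o\<^sub>L H"
      using gh in_ball
      by (intro has_symbol_unique[OF G has_symbol_compose[OF has_symbol_op_power[OF B] H]])
         (simp add: less_imp_le)
    then have "blinfun_apply (op_power ?B n) (blinfun_apply H x) = 0"
      using less.prems(4) by simp
    then have Hx: "blinfun_apply H x = 0"
      by (rule op_power_injective[rotated])
         (rule shift_minus_boundary_injective[OF \<rho> \<open>cmod \<zeta> = \<rho>\<close>])
    show ?thesis by (rule less.hyps[OF card h(1) _ H Hx]) (rule nzh)
  qed
qed

text \<open>
  \<open>exp (t w) = 1\<close> forces \<open>t w \<in> 2 \<pi> \<i> \<int>\<close>, so that \<open>exp (t f) - 1\<close> has no zeros in the open disc.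
\<close>
corollary exponential_fixed_point_trivial:
  assumes \<rho>: "\<rho> > 0" and U: "open U" "cball 0 \<rho> \<subseteq> U" and f: "f holomorphic_on U"
    and re: "\<And>z. z \<in> ball 0 \<rho> \<Longrightarrow> Re (f z) \<noteq> 0"
    and t: "t > 0" and T: "has_symbol T (\<lambda>l. exp (of_real t * f (of_real \<rho> * l)))"
    and x: "blinfun_apply T x = x"
  shows "x = 0"
proof (rule symbol_injective[OF \<rho> U])
  show "(\<lambda>z. exp (of_real t * f z) - 1) holomorphic_on U"
    by (intro holomorphic_intros f)
  show "exp (of_real t * f z) - 1 \<noteq> 0" if "z \<in> ball 0 \<rho>" for z
    using re[OF that] t by (auto simp: exp_eq_1)
  show "has_symbol (T - id_blinfun) (\<lambda>l. exp (of_real t * f (of_real \<rho> * l)) - 1)"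
    by (intro has_symbol_diff T has_symbol_id)
  show "blinfun_apply (T - id_blinfun) x = 0" using x by (simp add: blinfun.diff_left)
qed

section \<open>Transfer to the Herzog space\<close>

lemma herzog_summable:
  "summable (\<lambda>n. (c0_nth a n * of_real (\<rho> ^ n / fact n)) * (z :: complex) ^ n)"
proof (rule summable_comparison_test')
  show "summable (\<lambda>n. norm a * (inverse (fact n) * (\<bar>\<rho>\<bar> * cmod z) ^ n))"
    by (intro summable_mult summable_exp)
  fix n
  have "norm ((c0_nth a n * of_real (\<rho> ^ n / fact n)) * z ^ n)
      = cmod (c0_nth a n) * (inverse (fact n) * (\<bar>\<rho>\<bar> * cmod z) ^ n)"
    by (simp add: norm_mult norm_divide norm_power power_mult_distrib divide_inverse norm_inverse norm_fact)
  also have "\<dots> \<le> norm a * (inverse (fact n) * (\<bar>\<rho>\<bar> * cmod z) ^ n)"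
    by (intro mult_right_mono c0_nth_le_norm) simp
  finally show "norm ((c0_nth a n * of_real (\<rho> ^ n / fact n)) * z ^ n)
      \<le> norm a * (inverse (fact n) * (\<bar>\<rho>\<bar> * cmod z) ^ n)" .
qed

lemma herzog_fun_eq:
  "herzog_fun \<rho> a x = (\<Sum>n. (c0_nth a n * of_real (\<rho> ^ n / fact n)) * of_real x ^ n)"
  unfolding herzog_fun_def by (simp add: mult.assoc)

lemma herzog_fun_diff: "herzog_fun \<rho> a x - herzog_fun \<rho> b x = herzog_fun \<rho> (a - b) x"
  unfolding herzog_fun_eq by (subst suminf_diff[OF herzog_summable herzog_summable]) (simp only: c0_nth_simps left_diff_distrib)

lemma herzog_fun_0: "herzog_fun \<rho> 0 x = 0"
  by (simp add: herzog_fun_def)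

lemma herzog_fun_minus: "herzog_fun \<rho> (- a) x = - herzog_fun \<rho> a x"
  using herzog_fun_diff[of \<rho> 0 x a] by (simp add: herzog_fun_0)

lemma herzog_fun_at_0: "herzog_fun \<rho> a 0 = c0_nth a 0"
  unfolding herzog_fun_eq of_real_0 powser_zero by simp

lemma herzog_fun_has_derivative:
  "(herzog_fun \<rho> a has_vector_derivative herzog_fun \<rho> (blinfun_apply (scaled_shift \<rho>) a) x) (at x)"
proof -
  define c where "c n = c0_nth a n * of_real (\<rho> ^ n / fact n)" for n
  have "((\<lambda>z. \<Sum>n. c n * z ^ n) has_field_derivative (\<Sum>n. diffs c n * of_real x ^ n)) (at (of_real x))"
    by (rule termdiffs_strong_converges_everywhere) (simp only: c_def herzog_summable)
  then have "((\<lambda>y. \<Sum>n. c n * of_real y ^ n) has_vector_derivative (\<Sum>n. diffs c n * of_real x ^ n)) (at x)"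
    by (rule has_vector_derivative_real_field)
  moreover have "diffs c n = c0_nth (blinfun_apply (scaled_shift \<rho>) a) n * of_real (\<rho> ^ n / fact n)" for n
    by (simp add: diffs_def c_def field_simps del: of_nat_Suc)
  moreover have "(\<lambda>y. \<Sum>n. c n * of_real y ^ n) = herzog_fun \<rho> a"
    by (simp add: fun_eq_iff herzog_fun_eq c_def)
  ultimately show ?thesis by (simp add: herzog_fun_eq)
qed

text \<open>
  Differentiation acts on the coefficients as \<open>\<rho> B\<close>, so the \<open>n\<close>-th derivative at 0 returns \<open>\<rho>\<^sup>n a\<^sub>n\<close>.
\<close>
lemma herzog_fun_inject:
  assumes \<rho>: "\<rho> > 0" and eq: "herzog_fun \<rho> a = herzog_fun \<rho> b"
  shows "a = b"
proof (rule c0_eqI)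
  fix n
  let ?S = "blinfun_apply (scaled_shift \<rho>)"
  have "herzog_fun \<rho> ((?S ^^ n) a) = herzog_fun \<rho> ((?S ^^ n) b)"
  proof (induction n)
    case (Suc n)
    show ?case
    proof
      fix x
      show "herzog_fun \<rho> ((?S ^^ Suc n) a) x = herzog_fun \<rho> ((?S ^^ Suc n) b) x"
        using herzog_fun_has_derivative[of \<rho> "(?S ^^ n) a" x] herzog_fun_has_derivative[of \<rho> "(?S ^^ n) b" x]
        unfolding Suc by (simp add: vector_derivative_unique_at)
    qed
  qed (simp add: eq)
  then have "c0_nth ((?S ^^ n) a) 0 = c0_nth ((?S ^^ n) b) 0"
    by (metis herzog_fun_at_0)
  moreover have "c0_nth ((?S ^^ n) x) k = of_real \<rho> ^ n * c0_nth x (n + k)" for x k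
    by (induction n arbitrary: k) auto
  ultimately show "c0_nth a n = c0_nth b n" using \<rho> by simp
qed

lemma herzog_fun_eq_iff: "\<rho> > 0 \<Longrightarrow> herzog_fun \<rho> a = herzog_fun \<rho> b \<longleftrightarrow> a = b"
  using herzog_fun_inject by blast

lemma herzog_coeffs_fun: "\<rho> > 0 \<Longrightarrow> herzog_coeffs \<rho> (herzog_fun \<rho> a) = a"
  unfolding herzog_coeffs_def by (auto intro!: the_equality dest: herzog_fun_inject)

lemma herzog_op_fun: "\<rho> > 0 \<Longrightarrow> herzog_op \<rho> A (herzog_fun \<rho> a) = herzog_fun \<rho> (blinfun_apply A a)"
  by (simp add: herzog_op_def herzog_coeffs_fun)

lemma herzog_op_funpow:
  "\<rho> > 0 \<Longrightarrow> (herzog_op \<rho> A ^^ k) (herzog_fun \<rho> a) = herzog_fun \<rho> ((blinfun_apply A ^^ k) a)"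
  by (induction k) (simp_all add: herzog_op_fun)

theorem herzog_deriv_eq:
  assumes \<rho>: "\<rho> > 0"
  shows "herzog_deriv \<rho> = scaled_shift \<rho>"
  unfolding herzog_deriv_def
proof (rule the_equality)
  show "\<forall>h\<in>herzog_space \<rho>. \<forall>x. (h has_vector_derivative herzog_op \<rho> (scaled_shift \<rho>) h x) (at x)"
    using herzog_fun_has_derivative by (auto simp: herzog_space_def herzog_op_fun[OF \<rho>])
  fix A assume A: "\<forall>h\<in>herzog_space \<rho>. \<forall>x. (h has_vector_derivative herzog_op \<rho> A h x) (at x)"
  show "A = scaled_shift \<rho>"
  proof (rule blinfun_eqI)
    fix a
    have "(herzog_fun \<rho> a has_vector_derivative herzog_fun \<rho> (blinfun_apply A a) x) (at x)" for x
      using A by (simp add: herzog_space_def herzog_op_fun[OF \<rho>])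
    then have "herzog_fun \<rho> (blinfun_apply A a) x = herzog_fun \<rho> (blinfun_apply (scaled_shift \<rho>) a) x" for x
      using herzog_fun_has_derivative by (rule vector_derivative_unique_at)
    then show "blinfun_apply A a = blinfun_apply (scaled_shift \<rho>) a"
      by (intro herzog_fun_inject[OF \<rho>]) auto
  qed
qed

lemma herzog_norm_fun: "\<rho> > 0 \<Longrightarrow> herzog_norm \<rho> (herzog_fun \<rho> a) = norm a"
  by (simp add: herzog_norm_def herzog_coeffs_fun norm_c0_def)

text \<open>
  The axioms of a metric space demand symmetry of the distance for all functions, including those outside
  the Herzog space. Such functions all have the same unspecified coefficient sequence.
\<close>
lemma herzog_norm_minus:
  assumes \<rho>: "\<rho> > 0"
  shows "herzog_norm \<rho> (\<lambda>x. - h x) = herzog_norm \<rho> h"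
proof (cases "h \<in> range (herzog_fun \<rho>)")
  case True
  then obtain a where a: "h = herzog_fun \<rho> a" by blast
  have "(\<lambda>x. - h x) = herzog_fun \<rho> (- a)" by (simp add: a fun_eq_iff herzog_fun_minus)
  then show ?thesis by (simp add: a herzog_norm_fun[OF \<rho>])
next
  case False
  have "(\<lambda>x. - h x) \<notin> range (herzog_fun \<rho>)"
  proof
    assume "(\<lambda>x. - h x) \<in> range (herzog_fun \<rho>)"
    then obtain a where a: "(\<lambda>x. - h x) = herzog_fun \<rho> a" by blast
    have "h = herzog_fun \<rho> (- a)" by (simp add: fun_eq_iff herzog_fun_minus fun_cong[OF a, symmetric])
    with False show False by blast
  qed
  with False have "herzog_coeffs \<rho> (\<lambda>x. - h x) = herzog_coeffs \<rho> h"
    unfolding herzog_coeffs_def by (metis rangeI)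
  then show ?thesis by (simp add: herzog_norm_def)
qed

lemma herzog_dist_fun:
  "\<rho> > 0 \<Longrightarrow> herzog_norm \<rho> (\<lambda>x. herzog_fun \<rho> a x - herzog_fun \<rho> b x) = dist a b"
  using herzog_norm_fun[of \<rho> "a - b"] by (simp add: herzog_fun_diff dist_norm)

text \<open>
  Nonnegativity, too, is needed for all functions; it holds because the formal norm of any function is the
  norm of some element of \<open>c\<^sub>0\<close>.
\<close>
lemma herzog_Metric_space:
  assumes \<rho>: "\<rho> > 0"
  shows "Metric_space (herzog_space \<rho>) (\<lambda>h k. herzog_norm \<rho> (\<lambda>x. h x - k x))"
proof
  show "0 \<le> herzog_norm \<rho> (\<lambda>x. h x - k x)" for h k
    unfolding herzog_norm_def norm_c0_def[symmetric] by simp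
  show "herzog_norm \<rho> (\<lambda>x. h x - k x) = herzog_norm \<rho> (\<lambda>x. k x - h x)" for h k
    using herzog_norm_minus[OF \<rho>, of "\<lambda>x. k x - h x"] by simp
  show "herzog_norm \<rho> (\<lambda>x. h x - k x) = 0 \<longleftrightarrow> h = k"
    if hk: "h \<in> herzog_space \<rho>" "k \<in> herzog_space \<rho>" for h k
  proof -
    obtain a b where "h = herzog_fun \<rho> a" "k = herzog_fun \<rho> b"
      using hk unfolding herzog_space_def by blast
    then show ?thesis by (simp only: herzog_dist_fun[OF \<rho>] herzog_fun_eq_iff[OF \<rho>] dist_eq_0_iff)
  qed
qed (auto simp: herzog_space_def herzog_dist_fun[OF \<rho>] intro: dist_triangle)

lemma topspace_herzog: "\<rho> > 0 \<Longrightarrow> topspace (herzog_topology \<rho>) = range (herzog_fun \<rho>)"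
  unfolding herzog_topology_def
  by (subst Metric_space.topspace_mtopology[OF herzog_Metric_space]) (simp_all add: herzog_space_def)

lemma herzog_closure_of:
  assumes \<rho>: "\<rho> > 0"
  shows "herzog_topology \<rho> closure_of (herzog_fun \<rho> ` S) = herzog_fun \<rho> ` closure S"
proof -
  interpret Metric_space "herzog_space \<rho>" "\<lambda>h k. herzog_norm \<rho> (\<lambda>x. h x - k x)"
    by (rule herzog_Metric_space[OF \<rho>])
  have ball: "herzog_fun \<rho> b \<in> mball (herzog_fun \<rho> a) r \<longleftrightarrow> dist b a < r" for a b r
    by (simp add: herzog_dist_fun[OF \<rho>] dist_commute) (simp add: herzog_space_def)
  define P where "P h \<longleftrightarrow> (\<forall>r>0. \<exists>k\<in>herzog_fun \<rho> ` S. k \<in> mball h r)" for h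
  have "mtopology closure_of (herzog_fun \<rho> ` S) = {h \<in> herzog_space \<rho>. P h}"
    by (simp add: metric_closure_of P_def)
  also have "\<dots> = herzog_fun \<rho> ` {a. P (herzog_fun \<rho> a)}"
    by (auto simp: herzog_space_def)
  also have "{a. P (herzog_fun \<rho> a)} = closure S"
    by (auto simp: P_def ball closure_approachable simp del: in_mball)
  finally show ?thesis by (simp add: herzog_topology_def)
qed

lemma herzog_dense_iff:
  assumes \<rho>: "\<rho> > 0"
  shows "herzog_topology \<rho> closure_of (herzog_fun \<rho> ` S) = topspace (herzog_topology \<rho>) \<longleftrightarrow> closure S = UNIV"
  unfolding herzog_closure_of[OF \<rho>] topspace_herzog[OF \<rho>]
  by (rule inj_image_eq_iff) (auto intro: injI herzog_fun_inject[OF \<rho>])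

theorem devaney_chaotic_herzog_iff:
  assumes \<rho>: "\<rho> > 0"
  shows "devaney_chaotic (herzog_topology \<rho>) (herzog_op \<rho> A) \<longleftrightarrow> chaotic_operator A"
proof -
  have "range (\<lambda>k. (herzog_op \<rho> A ^^ k) (herzog_fun \<rho> a))
      = herzog_fun \<rho> ` range (\<lambda>k. (blinfun_apply A ^^ k) a)" for a
    by (auto simp: herzog_op_funpow[OF \<rho>])
  moreover have "{h \<in> topspace (herzog_topology \<rho>). \<exists>k>0. (herzog_op \<rho> A ^^ k) h = h}
      = herzog_fun \<rho> ` {a. \<exists>k>0. (blinfun_apply A ^^ k) a = a}"
    by (auto simp: topspace_herzog[OF \<rho>] herzog_op_funpow[OF \<rho>] herzog_fun_eq_iff[OF \<rho>] intro!: imageI)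
  ultimately show ?thesis
    unfolding devaney_chaotic_def chaotic_operator_def
    \<comment> \<open>Only the range of the quantifier is rewritten; \<open>herzog_dense_iff\<close> needs the topspace intact.\<close>
    by (simp add: herzog_dense_iff[OF \<rho>] topspace_herzog[OF \<rho>, THEN arg_cong, of "\<lambda>S. Bex S P" for P])
qed

theorem devaney_chaotic_semigroup_herzog_iff:
  assumes \<rho>: "\<rho> > 0"
  shows "devaney_chaotic_semigroup (herzog_topology \<rho>) (\<lambda>t. herzog_op \<rho> (E t)) \<longleftrightarrow>
    (\<exists>a. closure ((\<lambda>t. blinfun_apply (E t) a) ` {0..}) = UNIV) \<and>
    closure {a. \<exists>t>0. blinfun_apply (E t) a = a} = UNIV"
proof -
  have "(\<lambda>t. herzog_op \<rho> (E t) (herzog_fun \<rho> a)) ` {0..}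
      = herzog_fun \<rho> ` (\<lambda>t. blinfun_apply (E t) a) ` {0..}" for a
    by (auto simp: herzog_op_fun[OF \<rho>] image_image)
  moreover have "{h \<in> topspace (herzog_topology \<rho>). \<exists>t>0. herzog_op \<rho> (E t) h = h}
      = herzog_fun \<rho> ` {a. \<exists>t>0. blinfun_apply (E t) a = a}"
    by (auto simp: topspace_herzog[OF \<rho>] herzog_op_fun[OF \<rho>] herzog_fun_eq_iff[OF \<rho>] intro!: imageI)
  ultimately show ?thesis
    unfolding devaney_chaotic_semigroup_def
    \<comment> \<open>Only the range of the quantifier is rewritten; \<open>herzog_dense_iff\<close> needs the topspace intact.\<close>
    by (simp add: herzog_dense_iff[OF \<rho>] topspace_herzog[OF \<rho>, THEN arg_cong, of "\<lambda>S. Bex S P" for P])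
qed

section \<open>The equivalence\<close>

lemma rescaled_nonconstant:
  fixes f :: "complex \<Rightarrow> complex"
  assumes \<rho>: "\<rho> > 0" and f: "continuous_on (cball 0 \<rho>) f" and nc: "\<not> f constant_on cball 0 \<rho>"
  shows "\<not> (\<lambda>l. f (of_real \<rho> * l)) constant_on ball 0 1"
proof
  assume "(\<lambda>l. f (of_real \<rho> * l)) constant_on ball 0 1"
  then obtain c where c: "\<And>l. cmod l < 1 \<Longrightarrow> f (of_real \<rho> * l) = c" by (auto simp: constant_on_def)
  have "f w = c" if "w \<in> ball 0 \<rho>" for w
    using c[of "w / of_real \<rho>"] that \<rho> by (simp add: norm_divide)
  then have "f constant_on ball 0 \<rho>" by (auto simp: constant_on_def)
  then have "f constant_on closure (ball 0 \<rho>)"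
    using f \<rho> by (intro constant_on_closureI) auto
  then show False using nc \<rho> by simp
qed

theorem theorem3p1:
  fixes \<rho> :: real and U :: "complex set" and f :: "complex \<Rightarrow> complex"
  assumes "\<rho> > 0"
    and "open U" and "cball 0 \<rho> \<subseteq> U" and "f holomorphic_on U"
    and "\<not> f constant_on cball 0 \<rho>"
  shows "let T = herzog_semigroup \<rho> U f; X = herzog_topology \<rho>;
             i = (f ` ball 0 \<rho> \<inter> {z. Re z = 0} \<noteq> {});
             ii = devaney_chaotic_semigroup X T;
             iii = (\<forall>t>0. devaney_chaotic X (T t));
             iv = (\<exists>t>0. devaney_chaotic X (T t))
         in (i \<longleftrightarrow> ii) \<and> (ii \<longleftrightarrow> iii) \<and> (iii \<longleftrightarrow> iv)"
proof -
  note \<rho> = assms(1) and U = assms(2,3) and f = assms(4)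
  define E where "E t = op_exp (t *\<^sub>R riesz_dunford U f (scaled_shift \<rho>))" for t :: real
  let ?\<phi> = "\<lambda>l. f (of_real \<rho> * l)"
  have E: "has_symbol (E t) (\<lambda>l. exp (of_real t * ?\<phi> l))" for t
    unfolding E_def by (intro has_symbol_op_exp has_symbol_scaleR has_symbol_riesz_dunford \<rho> U f)
  have T: "herzog_semigroup \<rho> U f = (\<lambda>t. herzog_op \<rho> (E t))"
    by (simp add: fun_eq_iff herzog_semigroup_def E_def herzog_deriv_eq[OF \<rho>])
  let ?i = "f ` ball 0 \<rho> \<inter> {z. Re z = 0} \<noteq> {}"
  let ?ii = "devaney_chaotic_semigroup (herzog_topology \<rho>) (herzog_semigroup \<rho> U f)"
  let ?chaotic = "\<lambda>t. devaney_chaotic (herzog_topology \<rho>) (herzog_semigroup \<rho> U f t)"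
  have chaotic: "?chaotic t \<longleftrightarrow> chaotic_operator (E t)" for t
    unfolding T by (rule devaney_chaotic_herzog_iff[OF \<rho>])
  have i_iii: "?chaotic t" if ?i "t > 0" for t
  proof -
    obtain z where z: "z \<in> ball 0 \<rho>" "Re (f z) = 0" using \<open>?i\<close> by auto
    define l where "l = z / of_real \<rho>"
    have l: "cmod l < 1" "Re (?\<phi> l) = 0" using z \<rho> by (auto simp: l_def norm_divide)
    have "of_real \<rho> * l \<in> cball 0 \<rho>" if "cmod l < 1" for l
      using that \<rho> by (simp add: norm_mult)
    then have "(\<lambda>l. of_real \<rho> * l) ` ball 0 1 \<subseteq> U" using U(2) by (force simp del: mem_cball)
    then have "?\<phi> holomorphic_on ball 0 1"
      by (intro holomorphic_on_compose_gen[OF _ f, unfolded o_def] holomorphic_intros)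
    moreover have "\<not> ?\<phi> constant_on ball 0 1"
      using assms(5) f U(2) by (intro rescaled_nonconstant \<rho>)
        (auto intro: holomorphic_on_imp_continuous_on holomorphic_on_subset)
    ultimately show ?thesis
      unfolding chaotic by (rule chaotic_exponential[OF E \<open>t > 0\<close> _ _ l])
  qed
  have iv_ii: ?ii if t: "t > 0" and ch: "?chaotic t" for t
  proof -
    have "op_power (E t) k = E (of_nat k * t)" for k
      by (rule has_symbol_unique[OF has_symbol_op_power[OF E] E])
         (simp add: exp_of_nat_mult[symmetric] mult_ac)
    then have iter: "(blinfun_apply (E t) ^^ k) a = blinfun_apply (E (of_nat k * t)) a" for k a
      by (simp add: funpow_blinfun)
    obtain a where a: "closure (range (\<lambda>k. (blinfun_apply (E t) ^^ k) a)) = UNIV"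
      and per: "closure {x. \<exists>k>0. (blinfun_apply (E t) ^^ k) x = x} = UNIV"
      using ch by (auto simp: chaotic chaotic_operator_def)
    have "range (\<lambda>k. (blinfun_apply (E t) ^^ k) a) \<subseteq> (\<lambda>s. blinfun_apply (E s) a) ` {0..}"
      using t by (auto simp: iter)
    then have "closure ((\<lambda>s. blinfun_apply (E s) a) ` {0..}) = UNIV"
      using closure_mono a by blast
    moreover have "{x. \<exists>k>0. (blinfun_apply (E t) ^^ k) x = x} \<subseteq> {x. \<exists>s>0. blinfun_apply (E s) x = x}"
    proof clarify
      fix x and k :: nat assume "k > 0" "(blinfun_apply (E t) ^^ k) x = x"
      then show "\<exists>s>0. blinfun_apply (E s) x = x"
        using t by (intro exI[of _ "of_nat k * t"]) (simp add: iter)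
    qed
    then have "closure {x. \<exists>s>0. blinfun_apply (E s) x = x} = UNIV"
      using closure_mono per by blast
    ultimately show ?thesis
      unfolding T devaney_chaotic_semigroup_herzog_iff[OF \<rho>] by blast
  qed
  have ii_i: ?i if ?ii
  proof (rule ccontr)
    assume "\<not> ?i"
    then have "Re (f z) \<noteq> 0" if "z \<in> ball 0 \<rho>" for z using that by blast
    then have "{x. \<exists>s>0. blinfun_apply (E s) x = x} \<subseteq> {0}"
      using exponential_fixed_point_trivial[OF \<rho> U f _ _ E] by blast
    then have "closure {x. \<exists>s>0. blinfun_apply (E s) x = x} \<subseteq> {0}"
      by (intro closure_minimal) auto
    moreover have "closure {x. \<exists>s>0. blinfun_apply (E s) x = x} = UNIV"
      using that unfolding T devaney_chaotic_semigroup_herzog_iff[OF \<rho>] by blast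
    moreover have "jet 0 0 \<noteq> 0" using c0_nth_jet_0[of 0 0] by auto
    ultimately show False by blast
  qed
  have "?i \<longleftrightarrow> ?ii" "?ii \<longleftrightarrow> (\<forall>t>0. ?chaotic t)" "(\<forall>t>0. ?chaotic t) \<longleftrightarrow> (\<exists>t>0. ?chaotic t)"
    using i_iii iv_ii ii_i zero_less_one[where 'a = real] by blast+
  then show ?thesis by (simp add: Let_def)
qed

end
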